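(* Consider the aggregation model $\partial_t\rho-\nabla\cdot(\rho\,\nabla K*\rho)=0$ with the quadratic potential $K=\frac12(\text{distance})^2$ on each of $\mathcal U_1\subset M_1$, $\mathcal U_2\subset M_2$ and $\mathcal U=\mathcal U_1\times\mathcal U_2\subset M=M_1\times M_2$. Suppose that there exist unique global weak solutions $\rho^1\in C([0,\infty);\mathcal P_1(\mathcal U_1))$ and $\rho^2\in C([0,\infty);\mathcal P_1(\mathcal U_2))$ to the model on $\mathcal U_1$ and $\mathcal U_2$, respectively, and suppose they reach asymptotic consensus, that is, there exist $p\in\mathcal U_1$ and $q\in\mathcal U_2$ such that $W_1(\rho^1_t,\delta_p)\to0$ and $W_1(\rho^2_t,\delta_q)\to0$ as $t\to\infty$. Assume moreover that there exist $\bar t>0$ and compact sets $Q_1\subset\mathcal U_1$ and $Q_2\subset\mathcal U_2$ such that $\operatorname{supp}(\rho^1_t)\subset Q_1$ and $\operatorname{supp}(\rho^2_t)\subset Q_2$ for all $t\in[\bar t,\infty)$. Then the unique global weak solution $\mu=\rho^1\otimes\rho^2$ (i.e. $\mu_t=\rho^1_t\otimes\rho^2_t$) to the model on $\mathcal U$ satisfies $W_1(\mu_t,\delta_{(p,q)})\to0$ as $t\to\infty$.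
   Context: $M_1,M_2$ are smooth, complete, connected Riemannian manifolds with intrinsic distances $d_1,d_2$; $M=M_1\times M_2$ carries the product metric, with distance $d((x,y),(\bar x,\bar y))=\sqrt{d_1(x,\bar x)^2+d_2(y,\bar y)^2}$. $\mathcal U_1\subset M_1$ and $\mathcal U_2\subset M_2$ are open and geodesically convex (any two points are joined by a unique minimizing geodesic, which stays in the set), and $\mathcal U=\mathcal U_1\times\mathcal U_2$. On $\mathcal V\subset\mathcal M$ denoting any of $\mathcal U_1\subset M_1,\mathcal U_2\subset M_2,\mathcal U\subset M$, with distance $d_{\mathcal M}$: the potential is $K(z,\bar z)=\frac12d_{\mathcal M}(z,\bar z)^2$, so that $\nabla_{\mathcal M}K_{\bar z}(z)=-\log_z\bar z$ for $z,\bar z\in\mathcal V$, where $K_{\bar z}(z)=K(z,\bar z)$ and $\log$ is the Riemannian logarithm. $\mathcal P_1(\mathcal V)$ is the set of Borel probability measures on $\mathcal V$ with finite first moment; $W_1$ is the 1-Wasserstein distance built on $d_{\mathcal M}$; curves in $C([0,T);\mathcal P_1(\mathcal V))$ are narrowly continuous. The velocity field of a curve $(\rho_t)_{t\in[0,T)}$ is $v[\rho](z,t)=-\int_{\mathcal V}\nabla_{\mathcal M}K_{\bar z}(z)\,d\rho_t(\bar z)=\int_{\mathcal V}\log_z\bar z\,d\rho_t(\bar z)$. A flow map generated by a time-dependent vector field $X$ on $\mathcal V$ and a set $\Sigma\subset\mathcal V$ on $[0,T)$, $T\in(0,\infty]$, is a map $\Psi_X:\Sigma\times[0,T)\to\mathcal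 V$, written $\Psi_X^t(z)$, with $\frac{d}{dt}\Psi_X^t(z)=X(\Psi_X^t(z),t)$ and $\Psi_X^0(z)=z$. A curve $(\rho_t)_{t\in[0,T)}$ is a weak solution if $v[\rho]$ generates a unique flow map $\Psi_{v[\rho]}$ defined on $\operatorname{supp}(\rho_0)\times[0,T)$ and $\rho_t=\Psi^t_{v[\rho]}\#\rho_0$ for all $t\in[0,T)$; it is global if $T=\infty$. Uniqueness of a weak solution is understood for its given initial datum. If $\rho^1\in C([0,\infty);\mathcal P_1(\mathcal U_1))$ and $\rho^2\in C([0,\infty);\mathcal P_1(\mathcal U_2))$ are the unique global weak solutions, on $\mathcal U_1$ and $\mathcal U_2$ respectively, to the aggregation model with the quadratic potential $K=\frac12(\text{distance})^2$ starting from $\rho^1_0$ and $\rho^2_0$, then $\rho^1\otimes\rho^2$ is the unique weak solution on $\mathcal U$ among curves in $C([0,\infty);\mathcal P_1(\mathcal U))$ starting from $\rho^1_0\otimes\rho^2_0$. *)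

theory Defs
  imports "HOL-Probability.Probability"
begin

section \<open>Riemannian manifolds\<close>

primrec Ck_on :: "nat \<Rightarrow> 'a::real_normed_vector set \<Rightarrow> ('a \<Rightarrow> 'b::real_normed_vector) \<Rightarrow> bool" where
  "Ck_on 0 S = (\<lambda>f. continuous_on S f)"
| "Ck_on (Suc k) S =
     (\<lambda>f. f differentiable_on S \<and> (\<forall>v. Ck_on k S (\<lambda>x. frechet_derivative f (at x) v)))"

definition smooth_on :: "'a::real_normed_vector set \<Rightarrow> ('a \<Rightarrow> 'b::real_normed_vector) \<Rightarrow> bool" where
  "smooth_on S f \<longleftrightarrow> (\<forall>k. Ck_on k S f)"

text \<open>
  A manifold is carried by a whole type \<open>'a\<close> and given by a family of charts, indexed by \<open>'i\<close>, with
  values in the model space \<open>'e\<close>. The metric tensor is given by its coordinate expressions: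
  \<open>metric M i \<xi> u v\<close> is the inner product of the tangent vectors with coordinates \<open>u\<close> and \<open>v\<close> in the
  chart \<open>i\<close>, at the point with coordinates \<open>\<xi>\<close>. Throughout, a tangent vector at \<open>x\<close> is handled
  through its coordinate vectors in all charts around \<open>x\<close>.
\<close>

record ('i, 'a, 'e) riemannian_structure =
  charts :: "'i set"
  dom :: "'i \<Rightarrow> 'a set"
  chart :: "'i \<Rightarrow> 'a \<Rightarrow> 'e"
  metric :: "'i \<Rightarrow> 'e \<Rightarrow> 'e \<Rightarrow> 'e \<Rightarrow> real"

definition charts_at :: "('i, 'a, 'e) riemannian_structure \<Rightarrow> 'a \<Rightarrow> 'i set" where
  "charts_at M x = {i \<in> charts M. x \<in> dom M i}"

definition chart_inv :: "('i, 'a, 'e) riemannian_structure \<Rightarrow> 'i \<Rightarrow> 'e \<Rightarrow> 'a" where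
  "chart_inv M i = inv_into (dom M i) (chart M i)"

definition transition :: "('i, 'a, 'e) riemannian_structure \<Rightarrow> 'i \<Rightarrow> 'i \<Rightarrow> 'e \<Rightarrow> 'e" where
  "transition M i j = chart M j \<circ> chart_inv M i"

definition smooth_manifold ::
    "('i, 'a::{metric_space,second_countable_topology}, 'e::euclidean_space) riemannian_structure \<Rightarrow> bool" where
  "smooth_manifold M \<longleftrightarrow>
     (\<Union>i\<in>charts M. dom M i) = UNIV \<and>
     (\<forall>i\<in>charts M. open (dom M i) \<and> open (chart M i ` dom M i) \<and>
        homeomorphism (dom M i) (chart M i ` dom M i) (chart M i) (chart_inv M i)) \<and>
     (\<forall>i\<in>charts M. \<forall>j\<in>charts M. smooth_on (chart M i ` (dom M i \<inter> dom M j)) (transition M i j))"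

definition metric_tensor ::
    "('i, 'a::{metric_space,second_countable_topology}, 'e::euclidean_space) riemannian_structure \<Rightarrow> bool" where
  "metric_tensor M \<longleftrightarrow>
     (\<forall>i\<in>charts M.
        (\<forall>\<xi>\<in>chart M i ` dom M i.
           bilinear (metric M i \<xi>) \<and>
           (\<forall>u v. metric M i \<xi> u v = metric M i \<xi> v u) \<and>
           (\<forall>u. u \<noteq> 0 \<longrightarrow> metric M i \<xi> u u > 0)) \<and>
        (\<forall>u v. smooth_on (chart M i ` dom M i) (\<lambda>\<xi>. metric M i \<xi> u v))) \<and>
     (\<forall>x. \<forall>i\<in>charts_at M x. \<forall>j\<in>charts_at M x. \<forall>u v.
        metric M i (chart M i x) u v =
        metric M j (chart M j x)
          (frechet_derivative (transition M i j) (at (chart M i x)) u)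
          (frechet_derivative (transition M i j) (at (chart M i x)) v))"

definition curve_velocity ::
    "('i, 'a, 'e::euclidean_space) riemannian_structure \<Rightarrow> 'i \<Rightarrow> (real \<Rightarrow> 'a) \<Rightarrow> real \<Rightarrow> 'e" where
  "curve_velocity M i \<gamma> t = vector_derivative (\<lambda>s. chart M i (\<gamma> s)) (at t within {0..1})"

definition C1_curve ::
    "('i, 'a::metric_space, 'e::euclidean_space) riemannian_structure \<Rightarrow> (real \<Rightarrow> 'a) \<Rightarrow> bool" where
  "C1_curve M \<gamma> \<longleftrightarrow>
     continuous_on {0..1} \<gamma> \<and>
     (\<forall>t\<in>{0..1}. \<forall>i\<in>charts_at M (\<gamma> t).
        (\<lambda>s. chart M i (\<gamma> s)) differentiable (at t within {0..1}) \<and>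
        continuous (at t within {0..1}) (curve_velocity M i \<gamma>))"

text \<open>The speed does not depend on the chart chosen around \<open>\<gamma> t\<close>.\<close>

definition speed ::
    "('i, 'a, 'e::euclidean_space) riemannian_structure \<Rightarrow> (real \<Rightarrow> 'a) \<Rightarrow> real \<Rightarrow> real" where
  "speed M \<gamma> t =
     (let i = (SOME i. i \<in> charts_at M (\<gamma> t))
      in sqrt (metric M i (chart M i (\<gamma> t)) (curve_velocity M i \<gamma> t) (curve_velocity M i \<gamma> t)))"

definition curve_length ::
    "('i, 'a, 'e::euclidean_space) riemannian_structure \<Rightarrow> (real \<Rightarrow> 'a) \<Rightarrow> real" where
  "curve_length M \<gamma> = integral {0..1} (speed M \<gamma>)"

text \<open>
  The curves in the infimum may have vanishing velocity. A piecewise \<open>C\<^sup>1\<close> curve can therefore be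
  slowed down at its corners into a \<open>C\<^sup>1\<close> curve of the same length, and the infimum is the same as
  over piecewise \<open>C\<^sup>1\<close> curves.
\<close>

definition riemannian_dist ::
    "('i, 'a::metric_space, 'e::euclidean_space) riemannian_structure \<Rightarrow> 'a \<Rightarrow> 'a \<Rightarrow> real" where
  "riemannian_dist M x y = (INF \<gamma>\<in>{\<gamma>. C1_curve M \<gamma> \<and> \<gamma> 0 = x \<and> \<gamma> 1 = y}. curve_length M \<gamma>)"

text \<open>
  The intrinsic distance of \<open>M\<close> is the distance \<open>dist\<close> of the carrier type, and completeness and
  second countability of \<open>M\<close> are expressed by the class \<^class>\<open>polish_space\<close>.
\<close>

definition complete_connected_riemannian_manifold ::
    "('i, 'a::polish_space, 'e::euclidean_space) riemannian_structure \<Rightarrow> bool" where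
  "complete_connected_riemannian_manifold M \<longleftrightarrow>
     smooth_manifold M \<and> metric_tensor M \<and> connected (UNIV :: 'a set) \<and>
     (\<forall>x y. dist x y = riemannian_dist M x y)"

text \<open>
  The distance used on a product manifold is \<open>dist\<close> on the product type, which is
  \<open>sqrt ((dist x x')\<^sup>2 + (dist y y')\<^sup>2)\<close> by definition.
\<close>

definition prod_manifold ::
    "('i, 'a, 'e) riemannian_structure \<Rightarrow> ('j, 'b, 'f) riemannian_structure \<Rightarrow>
     ('i \<times> 'j, 'a \<times> 'b, 'e \<times> 'f) riemannian_structure" where
  "prod_manifold M N = \<lparr>
     charts = charts M \<times> charts N,
     dom = (\<lambda>(i, j). dom M i \<times> dom N j),
     chart = (\<lambda>(i, j) (x, y). (chart M i x, chart N j y)),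
     metric = (\<lambda>(i, j) (\<xi>, \<eta>) (u, u') (v, v'). metric M i \<xi> u v + metric N j \<eta> u' v')\<rparr>"

section \<open>Geodesics and geodesic convexity\<close>

definition metric_derivative ::
    "('i, 'a, 'e::euclidean_space) riemannian_structure \<Rightarrow> 'i \<Rightarrow> 'e \<Rightarrow> 'e \<Rightarrow> 'e \<Rightarrow> 'e \<Rightarrow> real" where
  "metric_derivative M i \<xi> w u v = frechet_derivative (\<lambda>\<zeta>. metric M i \<zeta> u v) (at \<xi>) w"

text \<open>Christoffel symbols of the first kind of the Levi-Civita connection, contracted with \<open>u\<close>, \<open>v\<close>, \<open>w\<close>.\<close>

definition christoffel ::
    "('i, 'a, 'e::euclidean_space) riemannian_structure \<Rightarrow> 'i \<Rightarrow> 'e \<Rightarrow> 'e \<Rightarrow> 'e \<Rightarrow> 'e \<Rightarrow> real" where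
  "christoffel M i \<xi> u v w =
     (metric_derivative M i \<xi> u v w + metric_derivative M i \<xi> v u w - metric_derivative M i \<xi> w u v) / 2"

text \<open>
  With velocity \<open>v\<close> and coordinate acceleration \<open>a\<close>, the sum below is the inner product of the
  covariant acceleration of \<open>\<gamma>\<close> with \<open>w\<close>; geodesics are the curves whose covariant acceleration vanishes.
\<close>

definition geodesic ::
    "('i, 'a::metric_space, 'e::euclidean_space) riemannian_structure \<Rightarrow> (real \<Rightarrow> 'a) \<Rightarrow> bool" where
  "geodesic M \<gamma> \<longleftrightarrow>
     C1_curve M \<gamma> \<and>
     (\<forall>t\<in>{0..1}. \<forall>i\<in>charts_at M (\<gamma> t). \<exists>a.
        (curve_velocity M i \<gamma> has_vector_derivative a) (at t within {0..1}) \<and>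
        (\<forall>w. metric M i (chart M i (\<gamma> t)) a w
           + christoffel M i (chart M i (\<gamma> t)) (curve_velocity M i \<gamma> t) (curve_velocity M i \<gamma> t) w = 0))"

definition minimizing_geodesic ::
    "('i, 'a::metric_space, 'e::euclidean_space) riemannian_structure \<Rightarrow> 'a \<Rightarrow> 'a \<Rightarrow> (real \<Rightarrow> 'a) \<Rightarrow> bool" where
  "minimizing_geodesic M x y \<gamma> \<longleftrightarrow>
     geodesic M \<gamma> \<and> \<gamma> 0 = x \<and> \<gamma> 1 = y \<and> curve_length M \<gamma> = dist x y"

definition geodesically_convex ::
    "('i, 'a::metric_space, 'e::euclidean_space) riemannian_structure \<Rightarrow> 'a set \<Rightarrow> bool" where
  "geodesically_convex M V \<longleftrightarrow>
     (\<forall>x\<in>V. \<forall>y\<in>V. \<exists>\<gamma>. minimizing_geodesic M x y \<gamma> \<and> \<gamma> ` {0..1} \<subseteq> V \<and>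
        (\<forall>\<gamma>'. minimizing_geodesic M x y \<gamma>' \<longrightarrow> (\<forall>t\<in>{0..1}. \<gamma>' t = \<gamma> t)))"

section \<open>Probability measures and the Wasserstein distance\<close>

definition prob_measures_1 :: "'a::metric_space set \<Rightarrow> 'a measure set" where
  "prob_measures_1 V =
     {\<rho>. sets \<rho> = sets (restrict_space borel V) \<and> prob_space \<rho> \<and>
         (\<exists>z\<^sub>0\<in>V. integrable \<rho> (\<lambda>z. dist z z\<^sub>0))}"

definition supp :: "'a::topological_space measure \<Rightarrow> 'a set" where
  "supp \<rho> = {z \<in> space \<rho>. \<forall>B. open B \<and> z \<in> B \<longrightarrow> emeasure \<rho> (B \<inter> space \<rho>) > 0}"

definition dirac_on :: "'a::topological_space set \<Rightarrow> 'a \<Rightarrow> 'a measure" where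
  "dirac_on V p = return (restrict_space borel V) p"

definition couplings :: "'a measure \<Rightarrow> 'a measure \<Rightarrow> ('a \<times> 'a) measure set" where
  "couplings \<rho> \<sigma> =
     {\<pi>. sets \<pi> = sets (\<rho> \<Otimes>\<^sub>M \<sigma>) \<and> distr \<pi> \<rho> fst = \<rho> \<and> distr \<pi> \<sigma> snd = \<sigma>}"

definition W1 :: "'a::metric_space measure \<Rightarrow> 'a measure \<Rightarrow> ennreal" where
  "W1 \<rho> \<sigma> = (INF \<pi>\<in>couplings \<rho> \<sigma>. \<integral>\<^sup>+ (x, y). ennreal (dist x y) \<partial>\<pi>)"

definition time_interval :: "ereal \<Rightarrow> real set" where
  "time_interval T = {t. 0 \<le> t \<and> ereal t < T}"

definition narrowly_continuous :: "'a::topological_space set \<Rightarrow> ereal \<Rightarrow> (real \<Rightarrow> 'a measure) \<Rightarrow> bool" where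
  "narrowly_continuous V T \<rho> \<longleftrightarrow>
     (\<forall>f :: 'a \<Rightarrow> real. continuous_on V f \<and> bounded (f ` V) \<longrightarrow>
        continuous_on (time_interval T) (\<lambda>t. \<integral>z. f z \<partial>\<rho> t))"

definition curves_P1 :: "'a::metric_space set \<Rightarrow> ereal \<Rightarrow> (real \<Rightarrow> 'a measure) set" where
  "curves_P1 V T =
     {\<rho>. (\<forall>t\<in>time_interval T. \<rho> t \<in> prob_measures_1 V) \<and> narrowly_continuous V T \<rho>}"

section \<open>The aggregation model\<close>

definition potential :: "'a::metric_space \<Rightarrow> 'a \<Rightarrow> real" where
  "potential z' z = (dist z z')\<^sup>2 / 2"

definition has_gradient ::
    "('i, 'a, 'e::euclidean_space) riemannian_structure \<Rightarrow> 'i \<Rightarrow> ('a \<Rightarrow> real) \<Rightarrow> 'a \<Rightarrow> 'e \<Rightarrow> bool" where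
  "has_gradient M i f z w \<longleftrightarrow>
     ((\<lambda>\<xi>. f (chart_inv M i \<xi>)) has_derivative (\<lambda>u. metric M i (chart M i z) w u)) (at (chart M i z))"

definition gradient ::
    "('i, 'a, 'e::euclidean_space) riemannian_structure \<Rightarrow> 'i \<Rightarrow> ('a \<Rightarrow> real) \<Rightarrow> 'a \<Rightarrow> 'e" where
  "gradient M i f z = (THE w. has_gradient M i f z w)"

text \<open>A time-dependent vector field takes a chart, a point in its domain and a time to a coordinate vector.\<close>

definition velocity_field ::
    "('i, 'a::metric_space, 'e::euclidean_space) riemannian_structure \<Rightarrow> (real \<Rightarrow> 'a measure) \<Rightarrow>
     'i \<Rightarrow> 'a \<Rightarrow> real \<Rightarrow> 'e" where
  "velocity_field M \<rho> i z t = - (\<integral>z'. gradient M i (potential z') z \<partial>\<rho> t)"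

text \<open>
  Existence of the gradients and of the integral in \<^const>\<open>velocity_field\<close>. On an open geodesically
  convex set \<open>V\<close> the gradient of \<open>potential z'\<close> at \<open>z\<close> exists, being minus the Riemannian logarithm of
  \<open>z'\<close> at \<open>z\<close>, and has norm \<open>dist z z'\<close>; so this holds for every curve in \<open>curves_P1 V T\<close>.
\<close>

definition velocity_field_exists ::
    "('i, 'a::metric_space, 'e::euclidean_space) riemannian_structure \<Rightarrow> 'a set \<Rightarrow> ereal \<Rightarrow>
     (real \<Rightarrow> 'a measure) \<Rightarrow> bool" where
  "velocity_field_exists M V T \<rho> \<longleftrightarrow>
     (\<forall>t\<in>time_interval T. \<forall>z\<in>V. \<forall>i\<in>charts_at M z.
        (\<forall>z'\<in>V. \<exists>w. has_gradient M i (potential z') z w) \<and>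
        integrable (\<rho> t) (\<lambda>z'. gradient M i (potential z') z))"

text \<open>
  Continuity in time is stated separately because \<open>chart M i\<close> is arbitrary outside \<open>dom M i\<close>. At
  time 0 the derivative is one-sided.
\<close>

definition flow_map ::
    "('i, 'a::metric_space, 'e::euclidean_space) riemannian_structure \<Rightarrow> 'a set \<Rightarrow>
     ('i \<Rightarrow> 'a \<Rightarrow> real \<Rightarrow> 'e) \<Rightarrow> 'a set \<Rightarrow> ereal \<Rightarrow> (real \<Rightarrow> 'a \<Rightarrow> 'a) \<Rightarrow> bool" where
  "flow_map M V X \<Sigma> T \<Psi> \<longleftrightarrow>
     (\<forall>z\<in>\<Sigma>. \<Psi> 0 z = z \<and> continuous_on (time_interval T) (\<lambda>t. \<Psi> t z) \<and>
        (\<forall>t\<in>time_interval T. \<Psi> t z \<in> V \<and>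
           (\<forall>i\<in>charts_at M (\<Psi> t z).
              ((\<lambda>s. chart M i (\<Psi> s z)) has_vector_derivative X i (\<Psi> t z) t)
                (at t within time_interval T))))"

text \<open>
  The flow map is defined on \<open>supp (\<rho> 0)\<close> only, a set of full measure, so the push-forward is taken of
  the restriction of \<open>\<rho> 0\<close>. Measurability is explicit because \<^const>\<open>distr\<close> is meaningless without it.
\<close>

definition weak_solution ::
    "('i, 'a::metric_space, 'e::euclidean_space) riemannian_structure \<Rightarrow> 'a set \<Rightarrow> ereal \<Rightarrow>
     (real \<Rightarrow> 'a measure) \<Rightarrow> bool" where
  "weak_solution M V T \<rho> \<longleftrightarrow>
     0 < T \<and> \<rho> \<in> curves_P1 V T \<and> velocity_field_exists M V T \<rho> \<and>
     (\<exists>\<Psi>. flow_map M V (velocity_field M \<rho>) (supp (\<rho> 0)) T \<Psi> \<and>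
        (\<forall>\<Phi>. flow_map M V (velocity_field M \<rho>) (supp (\<rho> 0)) T \<Phi> \<longrightarrow>
           (\<forall>t\<in>time_interval T. \<forall>z\<in>supp (\<rho> 0). \<Phi> t z = \<Psi> t z)) \<and>
        (\<forall>t\<in>time_interval T.
           \<Psi> t \<in> restrict_space (\<rho> 0) (supp (\<rho> 0)) \<rightarrow>\<^sub>M restrict_space borel V \<and>
           \<rho> t = distr (restrict_space (\<rho> 0) (supp (\<rho> 0))) (restrict_space borel V) (\<Psi> t)))"

definition unique_global_weak_solution ::
    "('i, 'a::metric_space, 'e::euclidean_space) riemannian_structure \<Rightarrow> 'a set \<Rightarrow>
     (real \<Rightarrow> 'a measure) \<Rightarrow> bool" where
  "unique_global_weak_solution M V \<rho> \<longleftrightarrow>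
     weak_solution M V \<infinity> \<rho> \<and>
     (\<forall>\<sigma>. weak_solution M V \<infinity> \<sigma> \<and> \<sigma> 0 = \<rho> 0 \<longrightarrow> (\<forall>t\<ge>0. \<sigma> t = \<rho> t))"

end

theory Submission
  imports Defs
begin

text \<open>
  The model on the product decouples. Since the squared product distance is the sum of the squared
  distances (\<open>potential_prod\<close>) and the product metric is an orthogonal sum, the gradient of the potential
  splits into the gradients on the factors, each depending only on the source point in its own factor.
  Where it exists, the velocity field of a curve \<open>\<sigma>\<close> on \<open>U\<^sub>1 \<times> U\<^sub>2\<close> therefore has as components the velocity fields of the two
  marginals of \<open>\<sigma>\<close> (\<open>decoupled_velocity_field\<close>).

  A field of this form has a unique flow on a product of nonempty sets exactly if its components have unique flows, and the
  flow on the product then moves the two variables independently (\<open>unique_flow_map_pair\<close>,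
  \<open>unique_flow_map_components\<close>). The support of a tensor product is the product of the supports, and pushing
  a tensor product forward by such a map gives the tensor product of the push-forwards. So the tensor product of
  two solutions is a solution (\<open>weak_solution_pair\<close>). Conversely, a solution that starts from a tensor
  product remains the tensor product of its marginals, and these solve the model on the factors
  (\<open>weak_solution_marginals\<close>); uniqueness on the factors hence yields uniqueness on the product.

  Consensus follows since the Wasserstein distance to a Dirac mass has a closed form, the mean distance to
  the point (\<open>W1_dirac\<close>). On the product it is at most the sum of the distances on the factors
  (\<open>W1_pair_dirac_le\<close>), which tends to zero.
\<close>

section \<open>Product measures on subsets, and their supports\<close>

text \<open>
  Measures on \<open>V\<close> live on the trace \<open>restrict_space borel V\<close>, so a product measure on \<open>U \<times> V\<close> lives on a
  product of traces, while solutions on \<open>U \<times> V\<close> live on the trace of the product. The two agree because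
  each makes the two projections measurable.
\<close>

lemma sets_restrict_space_pair:
  "sets (restrict_space M A \<Otimes>\<^sub>M restrict_space N B) = sets (restrict_space (M \<Otimes>\<^sub>M N) (A \<times> B))"
  (is "sets ?P = sets ?R")
proof (rule antisym)
  have sp: "space ?P = space ?R"
    by (auto simp: space_pair_measure space_restrict_space)
  have "(\<lambda>z. z) \<in> ?P \<rightarrow>\<^sub>M M \<Otimes>\<^sub>M N"
  proof (rule measurable_pair)
    show "fst \<circ> (\<lambda>z. z) \<in> ?P \<rightarrow>\<^sub>M M"
      using measurable_comp[OF measurable_fst measurable_restrict_space1[OF measurable_ident]]
      by (simp add: comp_def id_def)
    show "snd \<circ> (\<lambda>z. z) \<in> ?P \<rightarrow>\<^sub>M N"
      using measurable_comp[OF measurable_snd measurable_restrict_space1[OF measurable_ident]]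
      by (simp add: comp_def id_def)
  qed
  then have 1: "(\<lambda>z. z) \<in> ?P \<rightarrow>\<^sub>M ?R"
    by (intro measurable_restrict_space2) (auto simp: space_pair_measure space_restrict_space)
  show "sets ?R \<subseteq> sets ?P"
  proof
    fix X assume "X \<in> sets ?R"
    then have "(\<lambda>z. z) -` X \<inter> space ?P \<in> sets ?P" "X \<subseteq> space ?R"
      using measurable_sets[OF 1] sets.sets_into_space by auto
    then show "X \<in> sets ?P" by (simp add: sp Int_absorb2)
  qed
  have 2: "(\<lambda>z. z) \<in> ?R \<rightarrow>\<^sub>M ?P"
  proof (rule measurable_pair)
    show "fst \<circ> (\<lambda>z. z) \<in> ?R \<rightarrow>\<^sub>M restrict_space M A"
      by (intro measurable_restrict_space2) (auto simp: space_restrict_space comp_def intro: measurable_restrict_space1)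
    show "snd \<circ> (\<lambda>z. z) \<in> ?R \<rightarrow>\<^sub>M restrict_space N B"
      by (intro measurable_restrict_space2) (auto simp: space_restrict_space comp_def intro: measurable_restrict_space1)
  qed
  show "sets ?P \<subseteq> sets ?R"
  proof
    fix X assume "X \<in> sets ?P"
    then have "(\<lambda>z. z) -` X \<inter> space ?R \<in> sets ?R" "X \<subseteq> space ?P"
      using measurable_sets[OF 2] sets.sets_into_space by auto
    then show "X \<in> sets ?R" by (simp add: sp[symmetric] Int_absorb2)
  qed
qed

lemma sets_borel_restrict_pair:
  fixes U :: "'a::second_countable_topology set" and V :: "'b::second_countable_topology set"
  shows "sets (restrict_space borel U \<Otimes>\<^sub>M restrict_space borel V) = sets (restrict_space borel (U \<times> V))"
  by (simp add: sets_restrict_space_pair borel_prod)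

lemma restrict_space_pair_measure:
  assumes "prob_space M" "prob_space N" and A: "A \<in> sets M" and B: "B \<in> sets N"
  shows "restrict_space M A \<Otimes>\<^sub>M restrict_space N B = restrict_space (M \<Otimes>\<^sub>M N) (A \<times> B)"
proof (rule pair_measure_eqI)
  interpret M: prob_space M by fact
  interpret N: prob_space N by fact
  show "sigma_finite_measure (restrict_space M A)" "sigma_finite_measure (restrict_space N B)"
    using A B by (auto intro!: sigma_finite_measure_restrict_space
        M.sigma_finite_measure_axioms N.sigma_finite_measure_axioms)
  fix X Y assume X: "X \<in> sets (restrict_space M A)" and Y: "Y \<in> sets (restrict_space N B)"
  have X': "X \<in> sets M" "X \<subseteq> A" and Y': "Y \<in> sets N" "Y \<subseteq> B"
    using X Y A B by (auto simp: sets_restrict_space_iff)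
  show "emeasure (restrict_space M A) X * emeasure (restrict_space N B) Y =
      emeasure (restrict_space (M \<Otimes>\<^sub>M N) (A \<times> B)) (X \<times> Y)"
  proof -
    have "emeasure (restrict_space M A) X = emeasure M X" "emeasure (restrict_space N B) Y = emeasure N Y"
      using A B X' Y' by (auto intro!: emeasure_restrict_space)
    moreover have "emeasure (restrict_space (M \<Otimes>\<^sub>M N) (A \<times> B)) (X \<times> Y) = emeasure (M \<Otimes>\<^sub>M N) (X \<times> Y)"
    proof (rule emeasure_restrict_space)
      have "A \<times> B \<in> sets (M \<Otimes>\<^sub>M N)" using A B by (rule pair_measureI)
      then show "A \<times> B \<inter> space (M \<Otimes>\<^sub>M N) \<in> sets (M \<Otimes>\<^sub>M N)" by simp
    qed (use X' Y' in blast)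
    ultimately show ?thesis
      using N.emeasure_pair_measure_Times[OF X'(1) Y'(1)] by simp
  qed
qed (rule sets_restrict_space_pair)

lemma open_Int_in_sets_restrict_borel:
  "open B \<Longrightarrow> B \<inter> V \<in> sets (restrict_space borel V)"
  unfolding sets_restrict_space by (rule image_eqI[of _ _ B]) auto

text \<open>
  The support is the space minus the union of all null open sets, so it is relatively closed.
\<close>

lemma supp_in_sets:
  assumes "sets \<rho> = sets (restrict_space borel V)"
  shows "supp \<rho> \<in> sets \<rho>"
proof -
  define N where "N = \<Union>{B. open B \<and> emeasure \<rho> (B \<inter> space \<rho>) = 0}"
  have "open N" by (auto simp: N_def)
  have sp: "space \<rho> = V" using sets_eq_imp_space_eq[OF assms] by (simp add: space_restrict_space)
  have "supp \<rho> = space \<rho> - N"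
    by (auto simp: supp_def N_def zero_less_iff_neq_zero)
  also have "\<dots> = V \<inter> - N" by (auto simp: sp)
  also have "\<dots> \<in> sets \<rho>"
    using \<open>open N\<close> by (auto simp: assms sets_restrict_space)
  finally show ?thesis .
qed

text \<open>
  Second countability is what gives the support full measure: the union of all null open sets is
  already the union of countably many of them.
\<close>

lemma AE_supp:
  fixes \<rho> :: "'a::second_countable_topology measure"
  assumes "sets \<rho> = sets (restrict_space borel V)"
  shows "AE z in \<rho>. z \<in> supp \<rho>"
proof -
  define F where "F = {B. open B \<and> emeasure \<rho> (B \<inter> space \<rho>) = 0}"
  have sp: "space \<rho> = V" using sets_eq_imp_space_eq[OF assms] by (simp add: space_restrict_space)
  obtain F' where F': "F' \<subseteq> F" "countable F'" "\<Union>F' = \<Union>F"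
    by (rule Lindelof[of F]) (auto simp: F_def)
  have null: "B \<inter> space \<rho> \<in> null_sets \<rho>" if "B \<in> F'" for B
  proof -
    have "open B" "emeasure \<rho> (B \<inter> space \<rho>) = 0" using that F'(1) by (auto simp: F_def)
    moreover have "B \<inter> space \<rho> \<in> sets \<rho>"
      using open_Int_in_sets_restrict_borel[OF \<open>open B\<close>] by (simp add: sp assms)
    ultimately show ?thesis by (simp add: null_sets_def)
  qed
  have "AE z in \<rho>. z \<notin> (\<Union>B\<in>F'. B \<inter> space \<rho>)"
    by (intro AE_not_in null_sets_UN' F'(2) null)
  then show ?thesis
  proof (rule AE_mp, intro AE_I2 impI)
    fix z assume z: "z \<in> space \<rho>" "z \<notin> (\<Union>B\<in>F'. B \<inter> space \<rho>)"
    then have "z \<notin> \<Union>F" using F'(3) by auto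
    with z(1) show "z \<in> supp \<rho>"
      by (auto simp: supp_def F_def zero_less_iff_neq_zero)
  qed
qed

lemma emeasure_supp:
  fixes \<rho> :: "'a::second_countable_topology measure"
  assumes "sets \<rho> = sets (restrict_space borel V)" "prob_space \<rho>"
  shows "emeasure \<rho> (supp \<rho>) = 1"
  using prob_space.emeasure_eq_1_AE[OF assms(2) supp_in_sets[OF assms(1)] AE_supp[OF assms(1)]] .

lemma supp_nonempty:
  fixes \<rho> :: "'a::second_countable_topology measure"
  assumes "sets \<rho> = sets (restrict_space borel V)" "prob_space \<rho>"
  shows "supp \<rho> \<noteq> {}"
  using emeasure_supp[OF assms] by auto

text \<open>
  Boxes form a base of the product topology, and the mass of a box is the product of the masses of
  its sides; so every neighbourhood of \<open>(x, y)\<close> has positive mass iff this holds for \<open>x\<close> and for \<open>y\<close>.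
\<close>

lemma supp_pair:
  fixes \<mu> :: "'a::second_countable_topology measure" and \<nu> :: "'b::second_countable_topology measure"
  assumes \<mu>: "sets \<mu> = sets (restrict_space borel U)" "prob_space \<mu>"
    and \<nu>: "sets \<nu> = sets (restrict_space borel V)" "prob_space \<nu>"
  shows "supp (\<mu> \<Otimes>\<^sub>M \<nu>) = supp \<mu> \<times> supp \<nu>"
proof -
  interpret \<mu>: prob_space \<mu> by fact
  interpret \<nu>: prob_space \<nu> by fact
  have sp: "space \<mu> = U" "space \<nu> = V"
    using sets_eq_imp_space_eq[OF \<mu>(1)] sets_eq_imp_space_eq[OF \<nu>(1)] by (simp_all add: space_restrict_space)
  have sets: "sets (\<mu> \<Otimes>\<^sub>M \<nu>) = sets (restrict_space borel (U \<times> V))"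
    using \<mu>(1) \<nu>(1) sets_borel_restrict_pair[of U V] by (metis sets_pair_measure_cong)
  have meas: "A \<inter> U \<in> sets \<mu>" "B \<inter> V \<in> sets \<nu>" if "open A" "open B" for A B
    using that by (simp_all add: \<mu>(1) \<nu>(1) open_Int_in_sets_restrict_borel)
  have box: "emeasure (\<mu> \<Otimes>\<^sub>M \<nu>) ((A \<times> B) \<inter> U \<times> V) = emeasure \<mu> (A \<inter> U) * emeasure \<nu> (B \<inter> V)"
    if "open A" "open B" for A B
  proof -
    have "(A \<times> B) \<inter> U \<times> V = (A \<inter> U) \<times> (B \<inter> V)" by auto
    then show ?thesis using meas[OF that] by (simp add: \<nu>.emeasure_pair_measure_Times)
  qed
  show ?thesis
  proof (intro set_eqI iffI)
    fix z assume z: "z \<in> supp (\<mu> \<Otimes>\<^sub>M \<nu>)"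
    obtain x y where xy: "z = (x, y)" by force
    have in_UV: "x \<in> U" "y \<in> V" using z by (auto simp: supp_def space_pair_measure sp xy)
    have pos: "emeasure \<mu> (A \<inter> U) * emeasure \<nu> (B \<inter> V) > 0"
      if "open A" "x \<in> A" "open B" "y \<in> B" for A B
    proof -
      have "0 < emeasure (\<mu> \<Otimes>\<^sub>M \<nu>) ((A \<times> B) \<inter> U \<times> V)"
        using z that open_Times[of A B] unfolding supp_def xy space_pair_measure sp by blast
      then show ?thesis by (simp only: box[OF that(1,3)])
    qed
    have "emeasure \<mu> (A \<inter> U) > 0" if "open A" "x \<in> A" for A
      using pos[OF that, of UNIV] by (auto simp: zero_less_iff_neq_zero)
    moreover have "emeasure \<nu> (B \<inter> V) > 0" if "open B" "y \<in> B" for B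
      using pos[of UNIV, OF _ _ that] by (auto simp: zero_less_iff_neq_zero)
    ultimately show "z \<in> supp \<mu> \<times> supp \<nu>"
      using in_UV by (auto simp: supp_def sp xy)
  next
    fix z assume z: "z \<in> supp \<mu> \<times> supp \<nu>"
    have "emeasure (\<mu> \<Otimes>\<^sub>M \<nu>) (C \<inter> U \<times> V) > 0" if C: "open C" "z \<in> C" for C
    proof -
      obtain A B where AB: "open A" "open B" "z \<in> A \<times> B" "A \<times> B \<subseteq> C"
        using open_prod_elim[OF C] .
      have "0 < emeasure \<mu> (A \<inter> U) * emeasure \<nu> (B \<inter> V)"
        using z AB by (auto simp: supp_def sp ennreal_zero_less_mult_iff)
      also have "\<dots> \<le> emeasure (\<mu> \<Otimes>\<^sub>M \<nu>) (C \<inter> U \<times> V)"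
        unfolding box[OF AB(1,2), symmetric]
      proof (rule emeasure_mono)
        show "A \<times> B \<inter> U \<times> V \<subseteq> C \<inter> U \<times> V" using AB(4) by blast
        show "C \<inter> U \<times> V \<in> sets (\<mu> \<Otimes>\<^sub>M \<nu>)"
          using open_Int_in_sets_restrict_borel[OF C(1)] by (simp add: sets)
      qed
      finally show ?thesis .
    qed
    then show "z \<in> supp (\<mu> \<Otimes>\<^sub>M \<nu>)"
      using z by (auto simp: supp_def space_pair_measure sp)
  qed
qed

section \<open>Marginals, and the Wasserstein distance to a Dirac mass\<close>

lemma measurable_dist_restrict_borel:
  fixes p :: "'a::metric_space"
  shows "(\<lambda>x. dist x p) \<in> borel_measurable (restrict_space borel V)"
  by (intro borel_measurable_continuous_on_restrict continuous_intros)

text \<open>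
  The second component of any coupling with a Dirac mass at \<open>p\<close> is almost surely \<open>p\<close>. Hence all
  couplings have the same cost, and the product measure shows that there is one.
\<close>

lemma W1_dirac:
  fixes \<rho> :: "'a::{metric_space,second_countable_topology} measure"
  assumes \<rho>: "sets \<rho> = sets (restrict_space borel V)" "prob_space \<rho>" and p: "p \<in> V"
  shows "W1 \<rho> (dirac_on V p) = (\<integral>\<^sup>+ x. ennreal (dist x p) \<partial>\<rho>)"
proof (rule antisym)
  let ?\<delta> = "dirac_on V p"
  interpret \<rho>: prob_space \<rho> by fact
  have spV: "space (restrict_space borel V) = V" by (simp add: space_restrict_space)
  have \<delta>: "prob_space ?\<delta>" unfolding dirac_on_def by (rule prob_space_return) (simp add: p spV)
  interpret \<delta>: prob_space ?\<delta> by fact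
  have sets\<delta>: "sets ?\<delta> = sets (restrict_space borel V)" by (simp add: dirac_on_def)
  have sets2: "sets (\<rho> \<Otimes>\<^sub>M ?\<delta>) = sets (restrict_space borel (V \<times> V))"
    using \<rho>(1) sets\<delta> sets_borel_restrict_pair[of V V] by (metis sets_pair_measure_cong)
  have "(\<lambda>z. dist (fst z) (snd z)) \<in> borel_measurable (restrict_space borel (V \<times> V))"
    by (intro borel_measurable_continuous_on_restrict continuous_intros)
  then have meas2: "(\<lambda>z. ennreal (dist (fst z) (snd z))) \<in> borel_measurable (\<rho> \<Otimes>\<^sub>M ?\<delta>)"
    by (simp add: measurable_cong_sets[OF sets2 refl])
  have meas1: "(\<lambda>x. ennreal (dist x p)) \<in> borel_measurable \<rho>"
    using measurable_dist_restrict_borel[of p V] by (simp add: measurable_cong_sets[OF \<rho>(1) refl])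
  have "distr (\<rho> \<Otimes>\<^sub>M ?\<delta>) \<rho> fst = \<rho>"
    by (rule \<delta>.distr_pair_fst)
  moreover have "distr (\<rho> \<Otimes>\<^sub>M ?\<delta>) ?\<delta> snd = ?\<delta>"
  proof (rule measure_eqI)
    fix A assume "A \<in> sets (distr (\<rho> \<Otimes>\<^sub>M ?\<delta>) ?\<delta> snd)"
    then have A: "A \<in> sets ?\<delta>" by simp
    then have "snd -` A \<inter> space (\<rho> \<Otimes>\<^sub>M ?\<delta>) = space \<rho> \<times> A"
      using sets.sets_into_space by (auto simp: space_pair_measure)
    then show "emeasure (distr (\<rho> \<Otimes>\<^sub>M ?\<delta>) ?\<delta> snd) A = emeasure ?\<delta> A"
      using A by (simp add: emeasure_distr \<delta>.emeasure_pair_measure_Times \<rho>.emeasure_space_1)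
  qed simp
  ultimately have "\<rho> \<Otimes>\<^sub>M ?\<delta> \<in> couplings \<rho> ?\<delta>"
    by (simp add: couplings_def)
  then have "W1 \<rho> ?\<delta> \<le> (\<integral>\<^sup>+ (x, y). ennreal (dist x y) \<partial>(\<rho> \<Otimes>\<^sub>M ?\<delta>))"
    unfolding W1_def by (rule INF_lower)
  also have "\<dots> = (\<integral>\<^sup>+ x. \<integral>\<^sup>+ y. ennreal (dist x y) \<partial>?\<delta> \<partial>\<rho>)"
    using \<delta>.nn_integral_fst[OF meas2] by (simp add: case_prod_unfold)
  also have "\<dots> = (\<integral>\<^sup>+ x. ennreal (dist x p) \<partial>\<rho>)"
  proof (rule nn_integral_cong)
    fix x
    have "(\<lambda>y. ennreal (dist x y)) \<in> borel_measurable (restrict_space borel V)"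
      using measurable_dist_restrict_borel[of x V] by (simp add: dist_commute)
    then show "(\<integral>\<^sup>+ y. ennreal (dist x y) \<partial>?\<delta>) = ennreal (dist x p)"
      unfolding dirac_on_def by (subst nn_integral_return) (simp_all add: p spV)
  qed
  finally show "W1 \<rho> ?\<delta> \<le> (\<integral>\<^sup>+ x. ennreal (dist x p) \<partial>\<rho>)" .
  show "(\<integral>\<^sup>+ x. ennreal (dist x p) \<partial>\<rho>) \<le> W1 \<rho> ?\<delta>"
    unfolding W1_def
  proof (rule INF_greatest)
    fix \<pi> assume "\<pi> \<in> couplings \<rho> ?\<delta>"
    then have sets\<pi>: "sets \<pi> = sets (\<rho> \<Otimes>\<^sub>M ?\<delta>)" and 1: "distr \<pi> \<rho> fst = \<rho>" and 2: "distr \<pi> ?\<delta> snd = ?\<delta>"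
      by (auto simp: couplings_def)
    have fst: "fst \<in> \<pi> \<rightarrow>\<^sub>M \<rho>" and snd: "snd \<in> \<pi> \<rightarrow>\<^sub>M ?\<delta>"
      by (simp_all add: measurable_cong_sets[OF sets\<pi> refl])
    have "{p} \<inter> V \<in> sets (restrict_space borel V)"
      unfolding sets_restrict_space by (rule image_eqI[of _ _ "{p}"]) auto
    then have "AE y in ?\<delta>. y = p"
      using p unfolding dirac_on_def
      by (subst AE_return) (auto simp: spV pred_def Int_def conj_commute cong: conj_cong)
    then have "AE y in distr \<pi> ?\<delta> snd. y = p"
      by (simp only: 2)
    then have "AE z in \<pi>. snd z = p"
      by (rule AE_distrD[OF snd])
    then have "(\<integral>\<^sup>+ (x, y). ennreal (dist x y) \<partial>\<pi>) = (\<integral>\<^sup>+ z. ennreal (dist (fst z) p) \<partial>\<pi>)"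
      by (intro nn_integral_cong_AE) auto
    also have "\<dots> = (\<integral>\<^sup>+ x. ennreal (dist x p) \<partial>distr \<pi> \<rho> fst)"
      using meas1 by (simp add: nn_integral_distr[OF fst])
    also have "\<dots> = (\<integral>\<^sup>+ x. ennreal (dist x p) \<partial>\<rho>)" by (simp only: 1)
    finally show "(\<integral>\<^sup>+ x. ennreal (dist x p) \<partial>\<rho>) \<le> (\<integral>\<^sup>+ (x, y). ennreal (dist x y) \<partial>\<pi>)" by simp
  qed
qed

definition fst_marginal :: "'a::topological_space set \<Rightarrow> ('a \<times> 'b) measure \<Rightarrow> 'a measure" where
  "fst_marginal U \<sigma> = distr \<sigma> (restrict_space borel U) fst"

definition snd_marginal :: "'b::topological_space set \<Rightarrow> ('a \<times> 'b) measure \<Rightarrow> 'b measure" where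
  "snd_marginal V \<sigma> = distr \<sigma> (restrict_space borel V) snd"

lemma measurable_fst_snd_restrict_borel:
  fixes \<sigma> :: "('a::second_countable_topology \<times> 'b::second_countable_topology) measure"
  assumes "sets \<sigma> = sets (restrict_space borel (U \<times> V))"
  shows "fst \<in> \<sigma> \<rightarrow>\<^sub>M restrict_space borel U" "snd \<in> \<sigma> \<rightarrow>\<^sub>M restrict_space borel V"
  by (simp_all add: measurable_cong_sets[OF assms[folded sets_borel_restrict_pair] refl])

lemma marginals_pair_measure:
  assumes \<mu>: "sets \<mu> = sets (restrict_space borel U)" "prob_space \<mu>"
    and \<nu>: "sets \<nu> = sets (restrict_space borel V)" "prob_space \<nu>"
  shows "fst_marginal U (\<mu> \<Otimes>\<^sub>M \<nu>) = \<mu>" "snd_marginal V (\<mu> \<Otimes>\<^sub>M \<nu>) = \<nu>"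
proof -
  interpret \<mu>: prob_space \<mu> by fact
  interpret \<nu>: prob_space \<nu> by fact
  have "fst_marginal U (\<mu> \<Otimes>\<^sub>M \<nu>) = distr (\<mu> \<Otimes>\<^sub>M \<nu>) \<mu> fst"
    unfolding fst_marginal_def by (rule distr_cong) (simp_all add: \<mu>)
  also have "\<dots> = \<mu>" by (rule \<nu>.distr_pair_fst)
  finally show "fst_marginal U (\<mu> \<Otimes>\<^sub>M \<nu>) = \<mu>" .
  show "snd_marginal V (\<mu> \<Otimes>\<^sub>M \<nu>) = \<nu>"
    unfolding snd_marginal_def
  proof (rule measure_eqI)
    have snd: "snd \<in> \<mu> \<Otimes>\<^sub>M \<nu> \<rightarrow>\<^sub>M restrict_space borel V"
      using measurable_snd[of \<mu> \<nu>] by (simp add: measurable_cong_sets[OF refl \<nu>(1)])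
    fix A assume "A \<in> sets (distr (\<mu> \<Otimes>\<^sub>M \<nu>) (restrict_space borel V) snd)"
    then have A: "A \<in> sets (restrict_space borel V)" "A \<in> sets \<nu>" by (simp_all add: \<nu>)
    then have "snd -` A \<inter> space (\<mu> \<Otimes>\<^sub>M \<nu>) = space \<mu> \<times> A"
      using sets.sets_into_space by (auto simp: space_pair_measure)
    then show "emeasure (distr (\<mu> \<Otimes>\<^sub>M \<nu>) (restrict_space borel V) snd) A = emeasure \<nu> A"
      using A(2) by (simp add: emeasure_distr[OF snd A(1)] \<nu>.emeasure_pair_measure_Times \<mu>.emeasure_space_1)
  qed (simp add: \<nu>)
qed

lemma prob_measures_1_pair:
  fixes \<mu> :: "'a::{metric_space,second_countable_topology} measure"
    and \<nu> :: "'b::{metric_space,second_countable_topology} measure"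
  assumes "\<mu> \<in> prob_measures_1 U" "\<nu> \<in> prob_measures_1 V"
  shows "\<mu> \<Otimes>\<^sub>M \<nu> \<in> prob_measures_1 (U \<times> V)"
proof -
  from assms obtain x0 y0 where \<mu>: "sets \<mu> = sets (restrict_space borel U)" "prob_space \<mu>"
    and x0: "x0 \<in> U" "integrable \<mu> (\<lambda>x. dist x x0)"
    and \<nu>: "sets \<nu> = sets (restrict_space borel V)" "prob_space \<nu>"
    and y0: "y0 \<in> V" "integrable \<nu> (\<lambda>x. dist x y0)"
    by (auto simp: prob_measures_1_def)
  interpret \<mu>: prob_space \<mu> by fact
  interpret \<nu>: prob_space \<nu> by fact
  interpret pair_prob_space \<mu> \<nu> ..
  have sets: "sets (\<mu> \<Otimes>\<^sub>M \<nu>) = sets (restrict_space borel (U \<times> V))"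
    using \<mu>(1) \<nu>(1) sets_borel_restrict_pair[of U V] by (metis sets_pair_measure_cong)
  note fs = measurable_fst_snd_restrict_borel[OF sets]
  have "integrable (\<mu> \<Otimes>\<^sub>M \<nu>) (\<lambda>z. dist (fst z) x0)"
    using x0(2) marginals_pair_measure(1)[OF \<mu> \<nu>]
    by (intro integrable_distr[OF fs(1)]) (simp add: fst_marginal_def)
  moreover have "integrable (\<mu> \<Otimes>\<^sub>M \<nu>) (\<lambda>z. dist (snd z) y0)"
    using y0(2) marginals_pair_measure(2)[OF \<mu> \<nu>]
    by (intro integrable_distr[OF fs(2)]) (simp add: snd_marginal_def)
  ultimately have "integrable (\<mu> \<Otimes>\<^sub>M \<nu>) (\<lambda>z. dist (fst z) x0 + dist (snd z) y0)"
    by simp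
  then have "integrable (\<mu> \<Otimes>\<^sub>M \<nu>) (\<lambda>z. dist z (x0, y0))"
  proof (rule Bochner_Integration.integrable_bound)
    show "(\<lambda>z. dist z (x0, y0)) \<in> borel_measurable (\<mu> \<Otimes>\<^sub>M \<nu>)"
      using measurable_dist_restrict_borel by (simp add: measurable_cong_sets[OF sets refl])
    show "AE z in \<mu> \<Otimes>\<^sub>M \<nu>. norm (dist z (x0, y0)) \<le> norm (dist (fst z) x0 + dist (snd z) y0)"
      by (intro AE_I2) (auto simp: dist_prod_def intro!: sqrt_sum_squares_le_sum)
  qed
  then show ?thesis
    using sets x0(1) y0(1) P.prob_space_axioms
    unfolding prob_measures_1_def by blast
qed

lemma prob_measures_1_marginals:
  fixes \<sigma> :: "('a::{metric_space,second_countable_topology} \<times> 'b::{metric_space,second_countable_topology}) measure"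
  assumes "\<sigma> \<in> prob_measures_1 (U \<times> V)"
  shows "fst_marginal U \<sigma> \<in> prob_measures_1 U" "snd_marginal V \<sigma> \<in> prob_measures_1 V"
proof -
  from assms obtain x0 y0 where sets: "sets \<sigma> = sets (restrict_space borel (U \<times> V))" and \<sigma>: "prob_space \<sigma>"
    and z0: "x0 \<in> U" "y0 \<in> V" "integrable \<sigma> (\<lambda>z. dist z (x0, y0))"
    by (auto simp: prob_measures_1_def)
  note fs = measurable_fst_snd_restrict_borel[OF sets]
  have "integrable (fst_marginal U \<sigma>) (\<lambda>x. dist x x0)"
    unfolding fst_marginal_def integrable_distr_eq[OF fs(1) measurable_dist_restrict_borel]
    using z0(3)
  proof (rule Bochner_Integration.integrable_bound)
    show "(\<lambda>z. dist (fst z) x0) \<in> borel_measurable \<sigma>"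
      by (rule measurable_compose[OF fs(1) measurable_dist_restrict_borel])
    show "AE z in \<sigma>. norm (dist (fst z) x0) \<le> norm (dist z (x0, y0))"
      using dist_fst_le[of _ "(x0, y0)"] by (intro AE_I2) simp
  qed
  then show "fst_marginal U \<sigma> \<in> prob_measures_1 U"
    using z0(1) prob_space.prob_space_distr[OF \<sigma> fs(1)] by (auto simp: prob_measures_1_def fst_marginal_def)
  have "integrable (snd_marginal V \<sigma>) (\<lambda>y. dist y y0)"
    unfolding snd_marginal_def integrable_distr_eq[OF fs(2) measurable_dist_restrict_borel]
    using z0(3)
  proof (rule Bochner_Integration.integrable_bound)
    show "(\<lambda>z. dist (snd z) y0) \<in> borel_measurable \<sigma>"
      by (rule measurable_compose[OF fs(2) measurable_dist_restrict_borel])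
    show "AE z in \<sigma>. norm (dist (snd z) y0) \<le> norm (dist z (x0, y0))"
      using dist_snd_le[of _ "(x0, y0)"] by (intro AE_I2) simp
  qed
  then show "snd_marginal V \<sigma> \<in> prob_measures_1 V"
    using z0(2) prob_space.prob_space_distr[OF \<sigma> fs(2)] by (auto simp: prob_measures_1_def snd_marginal_def)
qed

text \<open>
  By the explicit formula for the distance to a Dirac mass, this is the integral of
  \<open>sqrt (a\<^sup>2 + b\<^sup>2) \<le> a + b\<close> for nonnegative \<open>a\<close> and \<open>b\<close>.
\<close>

lemma W1_pair_dirac_le:
  fixes \<mu> :: "'a::{metric_space,second_countable_topology} measure"
    and \<nu> :: "'b::{metric_space,second_countable_topology} measure"
  assumes \<mu>: "sets \<mu> = sets (restrict_space borel U)" "prob_space \<mu>" and p: "p \<in> U"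
    and \<nu>: "sets \<nu> = sets (restrict_space borel V)" "prob_space \<nu>" and q: "q \<in> V"
  shows "W1 (\<mu> \<Otimes>\<^sub>M \<nu>) (dirac_on (U \<times> V) (p, q)) \<le> W1 \<mu> (dirac_on U p) + W1 \<nu> (dirac_on V q)"
proof -
  interpret \<mu>: prob_space \<mu> by fact
  interpret \<nu>: prob_space \<nu> by fact
  interpret pair_prob_space \<mu> \<nu> ..
  have sets: "sets (\<mu> \<Otimes>\<^sub>M \<nu>) = sets (restrict_space borel (U \<times> V))"
    using \<mu>(1) \<nu>(1) sets_borel_restrict_pair[of U V] by (metis sets_pair_measure_cong)
  note fs = measurable_fst_snd_restrict_borel[OF sets]
  have m: "(\<lambda>x. ennreal (dist x p)) \<in> borel_measurable (restrict_space borel U)"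
      "(\<lambda>y. ennreal (dist y q)) \<in> borel_measurable (restrict_space borel V)"
    using measurable_dist_restrict_borel by simp_all
  have "W1 (\<mu> \<Otimes>\<^sub>M \<nu>) (dirac_on (U \<times> V) (p, q)) = (\<integral>\<^sup>+ z. ennreal (dist z (p, q)) \<partial>(\<mu> \<Otimes>\<^sub>M \<nu>))"
    using p q by (intro W1_dirac[OF sets P.prob_space_axioms]) simp
  also have "\<dots> \<le> (\<integral>\<^sup>+ z. ennreal (dist (fst z) p) + ennreal (dist (snd z) q) \<partial>(\<mu> \<Otimes>\<^sub>M \<nu>))"
    by (intro nn_integral_mono)
       (auto simp: dist_prod_def ennreal_plus[symmetric] simp del: ennreal_plus
         intro!: ennreal_leI sqrt_sum_squares_le_sum)
  also have "\<dots> = (\<integral>\<^sup>+ z. ennreal (dist (fst z) p) \<partial>(\<mu> \<Otimes>\<^sub>M \<nu>)) + (\<integral>\<^sup>+ z. ennreal (dist (snd z) q) \<partial>(\<mu> \<Otimes>\<^sub>M \<nu>))"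
    by (intro nn_integral_add measurable_compose[OF fs(1) m(1)] measurable_compose[OF fs(2) m(2)])
  also have "\<dots> = (\<integral>\<^sup>+ x. ennreal (dist x p) \<partial>fst_marginal U (\<mu> \<Otimes>\<^sub>M \<nu>)) + (\<integral>\<^sup>+ y. ennreal (dist y q) \<partial>snd_marginal V (\<mu> \<Otimes>\<^sub>M \<nu>))"
    unfolding fst_marginal_def snd_marginal_def
    using m by (simp add: nn_integral_distr[OF fs(1)] nn_integral_distr[OF fs(2)])
  also have "\<dots> = W1 \<mu> (dirac_on U p) + W1 \<nu> (dirac_on V q)"
    by (simp only: marginals_pair_measure[OF \<mu> \<nu>] W1_dirac[OF \<mu> p] W1_dirac[OF \<nu> q])
  finally show ?thesis .
qed

text \<open>
  Time continuity of a transported measure comes from that of the trajectories, by dominated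
  convergence. The tensor product of two solutions is transported by a flow, so its continuity needs no
  argument about products of narrowly convergent measures.
\<close>

lemma narrowly_continuous_pushforward:
  fixes \<Psi> :: "real \<Rightarrow> 'z \<Rightarrow> 'a::topological_space"
  assumes "finite_measure \<mu>"
    and meas: "\<And>t. t \<in> time_interval T \<Longrightarrow> \<Psi> t \<in> \<mu> \<rightarrow>\<^sub>M restrict_space borel V"
    and cont: "\<And>z. z \<in> space \<mu> \<Longrightarrow> continuous_on (time_interval T) (\<lambda>t. \<Psi> t z)"
    and \<rho>: "\<And>t. t \<in> time_interval T \<Longrightarrow> \<rho> t = distr \<mu> (restrict_space borel V) (\<Psi> t)"
  shows "narrowly_continuous V T \<rho>"
  unfolding narrowly_continuous_def
proof (intro allI impI, elim conjE)
  interpret finite_measure \<mu> by fact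
  fix f :: "'a \<Rightarrow> real" assume f: "continuous_on V f" and "bounded (f ` V)"
  then obtain B where B: "\<And>v. v \<in> V \<Longrightarrow> norm (f v) \<le> B" by (auto simp: bounded_iff)
  have f_meas: "f \<in> borel_measurable (restrict_space borel V)"
    using f by (rule borel_measurable_continuous_on_restrict)
  have in_V: "\<Psi> t z \<in> V" if "t \<in> time_interval T" "z \<in> space \<mu>" for t z
    using measurable_space[OF meas[OF that(1)] that(2)] by (simp add: space_restrict_space)
  have "continuous_on (time_interval T) (\<lambda>t. \<integral>z. f (\<Psi> t z) \<partial>\<mu>)"
  proof (rule continuous_on_sequentiallyI)
    fix u a assume u: "\<forall>n. u n \<in> time_interval T" and a: "a \<in> time_interval T" and lim: "u \<longlonglongrightarrow> a"
    show "(\<lambda>n. \<integral>z. f (\<Psi> (u n) z) \<partial>\<mu>) \<longlonglongrightarrow> (\<integral>z. f (\<Psi> a z) \<partial>\<mu>)"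
    proof (rule integral_dominated_convergence[where w = "\<lambda>_. B"])
      show "(\<lambda>z. f (\<Psi> a z)) \<in> borel_measurable \<mu>"
        by (rule measurable_compose[OF meas[OF a] f_meas])
      show "(\<lambda>z. f (\<Psi> (u n) z)) \<in> borel_measurable \<mu>" for n
        using u by (intro measurable_compose[OF meas f_meas]) blast
      show "AE z in \<mu>. (\<lambda>n. f (\<Psi> (u n) z)) \<longlonglongrightarrow> f (\<Psi> a z)"
      proof (rule AE_I2)
        fix z assume z: "z \<in> space \<mu>"
        have "(\<lambda>n. \<Psi> (u n) z) \<longlonglongrightarrow> \<Psi> a z"
          using continuous_on_tendsto_compose[OF cont[OF z] lim a] u by simp
        then show "(\<lambda>n. f (\<Psi> (u n) z)) \<longlonglongrightarrow> f (\<Psi> a z)"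
          using in_V[OF _ z] u by (intro continuous_on_tendsto_compose[OF f _ in_V[OF a z]]) auto
      qed
      show "AE z in \<mu>. norm (f (\<Psi> (u n) z)) \<le> B" for n
        using u B in_V by (intro AE_I2) blast
    qed simp
  qed
  moreover have "(\<integral>z. f z \<partial>\<rho> t) = (\<integral>z. f (\<Psi> t z) \<partial>\<mu>)" if "t \<in> time_interval T" for t
    using integral_distr[OF meas[OF that] f_meas] by (simp add: \<rho>[OF that])
  ultimately show "continuous_on (time_interval T) (\<lambda>t. \<integral>z. f z \<partial>\<rho> t)"
    by (simp cong: continuous_on_cong)
qed

lemma measurable_sections_restrict_borel:
  fixes U :: "'a::second_countable_topology set" and V :: "'b::second_countable_topology set"
  shows "y \<in> V \<Longrightarrow> (\<lambda>x. (x, y)) \<in> restrict_space borel U \<rightarrow>\<^sub>M restrict_space borel (U \<times> V)"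
    and "x \<in> U \<Longrightarrow> (\<lambda>y. (x, y)) \<in> restrict_space borel V \<rightarrow>\<^sub>M restrict_space borel (U \<times> V)"
  using measurable_Pair1'[of x "restrict_space borel U" "restrict_space borel V"]
    measurable_Pair2'[of y "restrict_space borel V" "restrict_space borel U"]
  by (simp_all add: measurable_cong_sets[OF refl sets_borel_restrict_pair] space_restrict_space)

text \<open>
  Measurability of \<open>f\<close> is part of integrability with respect to the marginal, and does not follow from
  measurability of \<open>f \<circ> fst\<close> by mere composition; it is recovered on a slice of the product.
\<close>

lemma
  fixes \<sigma> :: "('a::second_countable_topology \<times> 'b::second_countable_topology) measure"
    and f :: "'a \<Rightarrow> 'e::euclidean_space" and g :: "'b \<Rightarrow> 'f::euclidean_space"
  assumes sets: "sets \<sigma> = sets (restrict_space borel (U \<times> V))" and "prob_space \<sigma>"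
  shows integrable_fst_snd_iff: "integrable \<sigma> (\<lambda>z. (f (fst z), g (snd z))) \<longleftrightarrow>
      integrable (fst_marginal U \<sigma>) f \<and> integrable (snd_marginal V \<sigma>) g" (is "?L \<longleftrightarrow> ?R")
    and integral_fst_snd: "integrable (fst_marginal U \<sigma>) f \<Longrightarrow> integrable (snd_marginal V \<sigma>) g \<Longrightarrow>
      (\<integral>z. (f (fst z), g (snd z)) \<partial>\<sigma>) = (\<integral>x. f x \<partial>fst_marginal U \<sigma>, \<integral>y. g y \<partial>snd_marginal V \<sigma>)"
proof -
  interpret prob_space \<sigma> by fact
  let ?h = "\<lambda>z. (f (fst z), g (snd z))"
  note fs = measurable_fst_snd_restrict_borel[OF sets]
  show iff: "?L \<longleftrightarrow> ?R"
  proof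
    assume h: ?L
    \<comment> \<open>The slices are taken through a point of \<open>U \<times> V\<close>, which exists as a probability space is nonempty.\<close>
    obtain x0 y0 where xy: "x0 \<in> U" "y0 \<in> V"
      using not_empty sets_eq_imp_space_eq[OF sets] by (auto simp: space_restrict_space)
    have h_meas: "?h \<in> borel_measurable (restrict_space borel (U \<times> V))"
      using borel_measurable_integrable[OF h] by (simp add: measurable_cong_sets[OF sets refl])
    have "(\<lambda>x. fst (?h (x, y0))) \<in> borel_measurable (restrict_space borel U)"
      by (intro borel_measurable_continuous_on[OF continuous_on_fst[OF continuous_on_id]]
          measurable_compose[OF measurable_sections_restrict_borel(1)[OF xy(2)] h_meas])
    then have f: "f \<in> borel_measurable (restrict_space borel U)" by simp
    have "(\<lambda>y. snd (?h (x0, y))) \<in> borel_measurable (restrict_space borel V)"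
      by (intro borel_measurable_continuous_on[OF continuous_on_snd[OF continuous_on_id]]
          measurable_compose[OF measurable_sections_restrict_borel(2)[OF xy(1)] h_meas])
    then have g: "g \<in> borel_measurable (restrict_space borel V)" by simp
    show ?R
      unfolding fst_marginal_def snd_marginal_def integrable_distr_eq[OF fs(1) f] integrable_distr_eq[OF fs(2) g]
      using integrable_bounded_linear[OF bounded_linear_fst h] integrable_bounded_linear[OF bounded_linear_snd h]
      by simp
  next
    assume ?R
    then have "integrable \<sigma> (\<lambda>z. f (fst z))" "integrable \<sigma> (\<lambda>z. g (snd z))"
      unfolding fst_marginal_def snd_marginal_def
      using integrable_distr[OF fs(1)] integrable_distr[OF fs(2)] by auto
    moreover have "bounded_linear (\<lambda>u. (u, 0))" "bounded_linear (\<lambda>u. (0, u))"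
      by (intro bounded_linear_intros)+
    ultimately have "integrable \<sigma> (\<lambda>z. (f (fst z), 0) + (0, g (snd z)))"
      by (intro Bochner_Integration.integrable_add) (auto intro: integrable_bounded_linear)
    then show ?L by simp
  qed
  assume fg: "integrable (fst_marginal U \<sigma>) f" "integrable (snd_marginal V \<sigma>) g"
  then have h: "integrable \<sigma> ?h" using iff by blast
  have "fst (\<integral>z. ?h z \<partial>\<sigma>) = (\<integral>x. f x \<partial>fst_marginal U \<sigma>)"
    using integral_bounded_linear[OF bounded_linear_fst h] borel_measurable_integrable[OF fg(1)]
    unfolding fst_marginal_def by (simp add: integral_distr[OF fs(1)])
  moreover have "snd (\<integral>z. ?h z \<partial>\<sigma>) = (\<integral>y. g y \<partial>snd_marginal V \<sigma>)"
    using integral_bounded_linear[OF bounded_linear_snd h] borel_measurable_integrable[OF fg(2)]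
    unfolding snd_marginal_def by (simp add: integral_distr[OF fs(2)])
  ultimately show "(\<integral>z. ?h z \<partial>\<sigma>) = (\<integral>x. f x \<partial>fst_marginal U \<sigma>, \<integral>y. g y \<partial>snd_marginal V \<sigma>)"
    by (metis prod.collapse)
qed

lemma prob_measures_1D:
  assumes "\<rho> \<in> prob_measures_1 V"
  shows "sets \<rho> = sets (restrict_space borel V)" "prob_space \<rho>" "space \<rho> = V" "V \<noteq> {}"
  using assms sets_eq_imp_space_eq[of \<rho> "restrict_space borel V"]
  by (auto simp: prob_measures_1_def space_restrict_space)

section \<open>Gradients and velocity fields on a product manifold\<close>

lemma prod_manifold_simps:
  "charts (prod_manifold M N) = charts M \<times> charts N"
  "dom (prod_manifold M N) (i, j) = dom M i \<times> dom N j"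
  "chart (prod_manifold M N) (i, j) (x, y) = (chart M i x, chart N j y)"
  "metric (prod_manifold M N) (i, j) (\<xi>, \<eta>) (u, u') (v, v') = metric M i \<xi> u v + metric N j \<eta> u' v'"
  by (simp_all add: prod_manifold_def)

lemma charts_at_prod_manifold:
  "charts_at (prod_manifold M N) (x, y) = charts_at M x \<times> charts_at N y"
  by (auto simp: charts_at_def prod_manifold_simps)

lemma charts_at_nonempty:
  "smooth_manifold M \<Longrightarrow> charts_at M x \<noteq> {}"
  by (fastforce simp: smooth_manifold_def charts_at_def)

lemma inj_on_chart:
  assumes "smooth_manifold M" "i \<in> charts M"
  shows "inj_on (chart M i) (dom M i)"
proof (rule inj_on_inverseI)
  show "chart_inv M i (chart M i x) = x" if "x \<in> dom M i" for x
    using assms that by (auto simp: smooth_manifold_def homeomorphism_def)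
qed

lemma open_chart_image:
  "smooth_manifold M \<Longrightarrow> i \<in> charts M \<Longrightarrow> open (chart M i ` dom M i)"
  by (simp add: smooth_manifold_def)

text \<open>
  On the range of the product chart only: elsewhere \<^const>\<open>inv_into\<close> takes arbitrary values, and those
  of the product need not be the pairs of those of the factors.
\<close>

lemma chart_inv_prod_manifold:
  assumes M: "smooth_manifold M" "i \<in> charts M" and N: "smooth_manifold N" "j \<in> charts N"
    and "\<xi> \<in> chart M i ` dom M i" "\<eta> \<in> chart N j ` dom N j"
  shows "chart_inv (prod_manifold M N) (i, j) (\<xi>, \<eta>) = (chart_inv M i \<xi>, chart_inv N j \<eta>)"
proof -
  obtain x y where xy: "x \<in> dom M i" "\<xi> = chart M i x" "y \<in> dom N j" "\<eta> = chart N j y"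
    using assms(5,6) by auto
  have inj: "inj_on (chart (prod_manifold M N) (i, j)) (dom (prod_manifold M N) (i, j))"
    using inj_on_chart[OF M] inj_on_chart[OF N] by (auto simp: inj_on_def prod_manifold_simps)
  have "chart_inv (prod_manifold M N) (i, j) (chart (prod_manifold M N) (i, j) (x, y)) = (x, y)"
    unfolding chart_inv_def by (rule inv_into_f_f[OF inj]) (simp add: prod_manifold_simps xy)
  moreover have "chart_inv M i \<xi> = x" "chart_inv N j \<eta> = y"
    unfolding chart_inv_def by (simp_all add: xy inv_into_f_f inj_on_chart[OF M] inj_on_chart[OF N])
  ultimately show ?thesis by (simp add: prod_manifold_simps xy)
qed

lemma metric_tensorD:
  assumes "metric_tensor M" "i \<in> charts M" "\<xi> \<in> chart M i ` dom M i"
  shows "bilinear (metric M i \<xi>)" "u \<noteq> 0 \<Longrightarrow> metric M i \<xi> u u > 0"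
  using assms by (auto simp: metric_tensor_def)

text \<open>
  Positive definiteness makes a vector determined by its inner products, and hence makes
  \<^const>\<open>gradient\<close> the actual gradient whenever there is one.
\<close>

lemma has_gradient_unique:
  assumes "metric_tensor M" "i \<in> charts_at M z"
    and "has_gradient M i f z w" "has_gradient M i f z w'"
  shows "w = w'"
proof (rule ccontr)
  assume "w \<noteq> w'"
  let ?g = "metric M i (chart M i z)"
  have g: "i \<in> charts M" "chart M i z \<in> chart M i ` dom M i"
    using assms(2) by (auto simp: charts_at_def)
  have "?g w = ?g w'"
    using has_derivative_unique assms(3,4) unfolding has_gradient_def by blast
  then have "?g (w - w') (w - w') = 0"
    by (simp add: bilinear_lsub[OF metric_tensorD(1)[OF assms(1) g]])
  moreover have "?g (w - w') (w - w') > 0"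
    using \<open>w \<noteq> w'\<close> by (intro metric_tensorD(2)[OF assms(1) g]) simp
  ultimately show False by simp
qed

lemma gradient_eqI:
  "metric_tensor M \<Longrightarrow> i \<in> charts_at M z \<Longrightarrow> has_gradient M i f z w \<Longrightarrow> gradient M i f z = w"
  unfolding gradient_def by (rule the_equality) (auto dest: has_gradient_unique)

text \<open>
  The reason for the decoupling: the square of the product distance is the sum of the squares.
\<close>

lemma potential_prod: "potential (x', y') (x, y) = potential x' x + potential y' y"
  by (simp add: potential_def dist_prod_def add_divide_distrib)

text \<open>
  For a sum of a function of \<open>x\<close> and a function of \<open>y\<close>, in the orthogonal sum of the two metrics, the
  gradient has the two gradients as components. The converse is needed as well, in order to pass from a
  solution on the product to its marginals; it follows by restricting the derivative to the slices
  through \<open>(x, y)\<close>.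
\<close>

lemma has_gradient_prod_iff:
  fixes M :: "('i, 'a::{metric_space,second_countable_topology}, 'e::euclidean_space) riemannian_structure"
    and N :: "('j, 'b::{metric_space,second_countable_topology}, 'f::euclidean_space) riemannian_structure"
  assumes M: "smooth_manifold M" "metric_tensor M" and N: "smooth_manifold N" "metric_tensor N"
    and i: "i \<in> charts_at M x" and j: "j \<in> charts_at N y"
    and h: "\<And>x y. h (x, y) = f x + g y"
  shows "has_gradient (prod_manifold M N) (i, j) h (x, y) (w, w') \<longleftrightarrow>
    has_gradient M i f x w \<and> has_gradient N j g y w'"
proof -
  let ?\<xi> = "chart M i x" and ?\<eta> = "chart N j y"
  let ?A = "chart M i ` dom M i" and ?B = "chart N j ` dom N j"
  have i': "i \<in> charts M" "?\<xi> \<in> ?A" and j': "j \<in> charts N" "?\<eta> \<in> ?B"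
    using i j by (auto simp: charts_at_def)
  note bil = metric_tensorD(1)[OF M(2) i'] metric_tensorD(1)[OF N(2) j']
  have opens: "open ?A" "open ?B"
    using open_chart_image M(1) N(1) i' j' by auto
  let ?F = "\<lambda>\<xi>. f (chart_inv M i \<xi>)" and ?G = "\<lambda>\<eta>. g (chart_inv N j \<eta>)"
  let ?H = "\<lambda>z. ?F (fst z) + ?G (snd z)"
  let ?D = "\<lambda>u. metric M i ?\<xi> w (fst u) + metric N j ?\<eta> w' (snd u)"
  have H: "h (chart_inv (prod_manifold M N) (i, j) z) = ?H z" if "z \<in> ?A \<times> ?B" for z
    using that chart_inv_prod_manifold[OF M(1) i'(1) N(1) j'(1), of "fst z" "snd z"]
    by (simp add: h mem_Times_iff)
  have D: "metric (prod_manifold M N) (i, j) (?\<xi>, ?\<eta>) (w, w') = ?D"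
    by (auto simp: prod_manifold_simps)
  have "has_gradient (prod_manifold M N) (i, j) h (x, y) (w, w') \<longleftrightarrow>
      (?H has_derivative ?D) (at (?\<xi>, ?\<eta>))"
    unfolding has_gradient_def prod_manifold_simps D
  proof
    assume "((\<lambda>z. h (chart_inv (prod_manifold M N) (i, j) z)) has_derivative ?D) (at (?\<xi>, ?\<eta>))"
    then show "(?H has_derivative ?D) (at (?\<xi>, ?\<eta>))"
      by (rule has_derivative_transform_within_open[OF _ open_Times[OF opens]]) (use i' j' H in auto)
  next
    assume "(?H has_derivative ?D) (at (?\<xi>, ?\<eta>))"
    then show "((\<lambda>z. h (chart_inv (prod_manifold M N) (i, j) z)) has_derivative ?D) (at (?\<xi>, ?\<eta>))"
      by (rule has_derivative_transform_within_open[OF _ open_Times[OF opens]]) (use i' j' H in auto)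
  qed
  also have "\<dots> \<longleftrightarrow> has_gradient M i f x w \<and> has_gradient N j g y w'"
    unfolding has_gradient_def
  proof (intro iffI conjI; (elim conjE)?)
    assume H': "(?H has_derivative ?D) (at (?\<xi>, ?\<eta>))"
    have "((\<lambda>\<xi>. ?H (\<xi>, ?\<eta>)) has_derivative (\<lambda>u. ?D (u, 0))) (at ?\<xi>)"
      using has_derivative_compose[OF has_derivative_Pair[OF has_derivative_ident has_derivative_const] H'] .
    then have "((\<lambda>\<xi>. ?F \<xi> + ?G ?\<eta>) has_derivative metric M i ?\<xi> w) (at ?\<xi>)"
      by (simp add: bilinear_rzero[OF bil(2)])
    from has_derivative_diff[OF this has_derivative_const[of "?G ?\<eta>"]]
    show "(?F has_derivative metric M i ?\<xi> w) (at ?\<xi>)" by simp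
    have "((\<lambda>\<eta>. ?H (?\<xi>, \<eta>)) has_derivative (\<lambda>u. ?D (0, u))) (at ?\<eta>)"
      using has_derivative_compose[OF has_derivative_Pair[OF has_derivative_const has_derivative_ident] H'] .
    then have "((\<lambda>\<eta>. ?F ?\<xi> + ?G \<eta>) has_derivative metric N j ?\<eta> w') (at ?\<eta>)"
      by (simp add: bilinear_rzero[OF bil(1)])
    from has_derivative_diff[OF this has_derivative_const[of "?F ?\<xi>"]]
    show "(?G has_derivative metric N j ?\<eta> w') (at ?\<eta>)" by simp
  next
    assume F: "(?F has_derivative metric M i ?\<xi> w) (at ?\<xi>)"
      and G: "(?G has_derivative metric N j ?\<eta> w') (at ?\<eta>)"
    have "((\<lambda>z. ?F (fst z)) has_derivative (\<lambda>u. metric M i ?\<xi> w (fst u))) (at (?\<xi>, ?\<eta>))"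
      using F has_derivative_compose[OF has_derivative_fst[OF has_derivative_ident[of "at (?\<xi>, ?\<eta>)"]], of ?F]
      by simp
    moreover have "((\<lambda>z. ?G (snd z)) has_derivative (\<lambda>u. metric N j ?\<eta> w' (snd u))) (at (?\<xi>, ?\<eta>))"
      using G has_derivative_compose[OF has_derivative_snd[OF has_derivative_ident[of "at (?\<xi>, ?\<eta>)"]], of ?G]
      by simp
    ultimately show "(?H has_derivative ?D) (at (?\<xi>, ?\<eta>))"
      by (rule has_derivative_add)
  qed
  finally show ?thesis .
qed

text \<open>
  Agreement is only required at points of \<open>U \<times> V\<close> and in charts around them, which is where a flow looks
  at the field and where the velocity fields are meaningful.
\<close>

definition decoupled ::
    "('i, 'a, 'e) riemannian_structure \<Rightarrow> 'a set \<Rightarrow> ('j, 'b, 'f) riemannian_structure \<Rightarrow> 'b set \<Rightarrow> ereal \<Rightarrow>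
     ('i \<times> 'j \<Rightarrow> 'a \<times> 'b \<Rightarrow> real \<Rightarrow> 'e \<times> 'f) \<Rightarrow> ('i \<Rightarrow> 'a \<Rightarrow> real \<Rightarrow> 'e) \<Rightarrow> ('j \<Rightarrow> 'b \<Rightarrow> real \<Rightarrow> 'f) \<Rightarrow> bool" where
  "decoupled M U N V T Z X Y \<longleftrightarrow>
     (\<forall>t\<in>time_interval T. \<forall>x\<in>U. \<forall>y\<in>V. \<forall>i\<in>charts_at M x. \<forall>j\<in>charts_at N y.
        Z (i, j) (x, y) t = (X i x t, Y j y t))"

context
  fixes M :: "('i, 'a::{metric_space,second_countable_topology}, 'e::euclidean_space) riemannian_structure"
    and N :: "('j, 'b::{metric_space,second_countable_topology}, 'f::euclidean_space) riemannian_structure"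
  assumes M: "smooth_manifold M" "metric_tensor M" and N: "smooth_manifold N" "metric_tensor N"
begin

lemma has_gradient_potential_prod_iff:
  assumes "i \<in> charts_at M x" "j \<in> charts_at N y"
  shows "has_gradient (prod_manifold M N) (i, j) (potential (x', y')) (x, y) (w, w') \<longleftrightarrow>
    has_gradient M i (potential x') x w \<and> has_gradient N j (potential y') y w'"
  by (rule has_gradient_prod_iff[OF M N assms]) (rule potential_prod)

lemma gradient_potential_exists_prod_iff:
  assumes "i \<in> charts_at M x" "j \<in> charts_at N y"
  shows "(\<exists>w. has_gradient (prod_manifold M N) (i, j) (potential (x', y')) (x, y) w) \<longleftrightarrow>
    (\<exists>w. has_gradient M i (potential x') x w) \<and> (\<exists>w. has_gradient N j (potential y') y w)"
  by (simp add: has_gradient_potential_prod_iff[OF assms])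

lemma gradient_potential_prod:
  assumes "i \<in> charts_at M x" "j \<in> charts_at N y"
    and "has_gradient M i (potential x') x w" "has_gradient N j (potential y') y w'"
  shows "gradient (prod_manifold M N) (i, j) (potential (x', y')) (x, y) = (w, w')"
  unfolding gradient_def
proof (rule the_equality)
  note iff = has_gradient_potential_prod_iff[OF assms(1,2), of x' y']
  show "has_gradient (prod_manifold M N) (i, j) (potential (x', y')) (x, y) (w, w')"
    using assms(3,4) by (simp add: iff)
  fix v assume v: "has_gradient (prod_manifold M N) (i, j) (potential (x', y')) (x, y) v"
  then show "v = (w, w')"
    using iff[of "fst v" "snd v"] has_gradient_unique[OF M(2) assms(1) assms(3)]
      has_gradient_unique[OF N(2) assms(2) assms(4)] by (metis prod.collapse)
qed

text \<open>
  The gradient of \<open>potential (x', y')\<close> has one component depending on \<open>x'\<close> only and one depending on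
  \<open>y'\<close> only. Its average over \<open>\<sigma> t\<close> therefore sees only the marginals of \<open>\<sigma> t\<close>, whether or not \<open>\<sigma> t\<close> is a
  product measure. The marginals enter through curves \<open>\<mu>\<close> and \<open>\<nu>\<close> that agree with them on the time interval, so
  that the results apply both to the marginals of a given \<open>\<sigma>\<close> and to the factors of a tensor product.
\<close>

context
  fixes U :: "'a set" and V :: "'b set" and T :: ereal
    and \<sigma> :: "real \<Rightarrow> ('a \<times> 'b) measure" and \<mu> :: "real \<Rightarrow> 'a measure" and \<nu> :: "real \<Rightarrow> 'b measure"
  assumes \<sigma>: "\<And>t. t \<in> time_interval T \<Longrightarrow> \<sigma> t \<in> prob_measures_1 (U \<times> V)"
    and \<mu>: "\<And>t. t \<in> time_interval T \<Longrightarrow> fst_marginal U (\<sigma> t) = \<mu> t"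
    and \<nu>: "\<And>t. t \<in> time_interval T \<Longrightarrow> snd_marginal V (\<sigma> t) = \<nu> t"
begin

lemma
  assumes t: "t \<in> time_interval T" and ij: "i \<in> charts_at M x" "j \<in> charts_at N y"
    and ex: "\<And>x'. x' \<in> U \<Longrightarrow> \<exists>w. has_gradient M i (potential x') x w"
      "\<And>y'. y' \<in> V \<Longrightarrow> \<exists>w. has_gradient N j (potential y') y w"
  shows integrable_gradient_prod_iff: "integrable (\<sigma> t) (\<lambda>z'. gradient (prod_manifold M N) (i, j) (potential z') (x, y)) \<longleftrightarrow>
      integrable (\<mu> t) (\<lambda>x'. gradient M i (potential x') x) \<and>
      integrable (\<nu> t) (\<lambda>y'. gradient N j (potential y') y)"
    and velocity_field_prod: "integrable (\<mu> t) (\<lambda>x'. gradient M i (potential x') x) \<Longrightarrow>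
      integrable (\<nu> t) (\<lambda>y'. gradient N j (potential y') y) \<Longrightarrow>
      velocity_field (prod_manifold M N) \<sigma> (i, j) (x, y) t = (velocity_field M \<mu> i x t, velocity_field N \<nu> j y t)"
proof -
  note \<sigma>t = prob_measures_1D[OF \<sigma>[OF t]]
  have grad: "gradient (prod_manifold M N) (i, j) (potential z') (x, y) =
      (gradient M i (potential (fst z')) x, gradient N j (potential (snd z')) y)" if z': "z' \<in> space (\<sigma> t)" for z'
  proof -
    have "fst z' \<in> U" "snd z' \<in> V" using z' by (auto simp: \<sigma>t(3))
    with ex obtain w w' where w: "has_gradient M i (potential (fst z')) x w" "has_gradient N j (potential (snd z')) y w'"
      by meson
    show ?thesis
      using gradient_potential_prod[OF ij w] gradient_eqI[OF M(2) ij(1) w(1)] gradient_eqI[OF N(2) ij(2) w(2)]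
      by simp
  qed
  note pair = integrable_fst_snd_iff[OF \<sigma>t(1,2), of "\<lambda>x'. gradient M i (potential x') x" "\<lambda>y'. gradient N j (potential y') y"]
    integral_fst_snd[OF \<sigma>t(1,2), of "\<lambda>x'. gradient M i (potential x') x" "\<lambda>y'. gradient N j (potential y') y"]
  show "integrable (\<sigma> t) (\<lambda>z'. gradient (prod_manifold M N) (i, j) (potential z') (x, y)) \<longleftrightarrow>
      integrable (\<mu> t) (\<lambda>x'. gradient M i (potential x') x) \<and>
      integrable (\<nu> t) (\<lambda>y'. gradient N j (potential y') y)"
  proof -
    have "integrable (\<sigma> t) (\<lambda>z'. gradient (prod_manifold M N) (i, j) (potential z') (x, y)) \<longleftrightarrow>
        integrable (\<sigma> t) (\<lambda>z'. (gradient M i (potential (fst z')) x, gradient N j (potential (snd z')) y))"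
      by (rule Bochner_Integration.integrable_cong[OF refl grad])
    then show ?thesis
      by (simp only: pair(1) \<mu>[OF t] \<nu>[OF t])
  qed
  show "velocity_field (prod_manifold M N) \<sigma> (i, j) (x, y) t = (velocity_field M \<mu> i x t, velocity_field N \<nu> j y t)"
    if "integrable (\<mu> t) (\<lambda>x'. gradient M i (potential x') x)"
      "integrable (\<nu> t) (\<lambda>y'. gradient N j (potential y') y)"
  proof -
    have "(\<integral>z'. gradient (prod_manifold M N) (i, j) (potential z') (x, y) \<partial>\<sigma> t) =
        (\<integral>z'. (gradient M i (potential (fst z')) x, gradient N j (potential (snd z')) y) \<partial>\<sigma> t)"
      by (rule Bochner_Integration.integral_cong[OF refl grad])
    then show ?thesis
      using pair(2) that by (simp add: velocity_field_def \<mu>[OF t] \<nu>[OF t])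
  qed
qed

lemma velocity_field_exists_prod_iff:
  "velocity_field_exists (prod_manifold M N) (U \<times> V) T \<sigma> \<longleftrightarrow>
    velocity_field_exists M U T \<mu> \<and> velocity_field_exists N V T \<nu>" (is "?L \<longleftrightarrow> ?R")
proof
  assume L: ?L
  have *: "(\<forall>x'\<in>U. \<exists>w. has_gradient M i (potential x') x w) \<and> integrable (\<mu> t) (\<lambda>x'. gradient M i (potential x') x) \<and>
    (\<forall>y'\<in>V. \<exists>w. has_gradient N j (potential y') y w) \<and> integrable (\<nu> t) (\<lambda>y'. gradient N j (potential y') y)"
    if t: "t \<in> time_interval T" and xy: "x \<in> U" "y \<in> V" and ij: "i \<in> charts_at M x" "j \<in> charts_at N y" for t x y i j
  proof -
    have "(i, j) \<in> charts_at (prod_manifold M N) (x, y)" using ij by (simp add: charts_at_prod_manifold)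
    then have ex: "\<And>x' y'. x' \<in> U \<Longrightarrow> y' \<in> V \<Longrightarrow> \<exists>w. has_gradient (prod_manifold M N) (i, j) (potential (x', y')) (x, y) w"
      and int: "integrable (\<sigma> t) (\<lambda>z'. gradient (prod_manifold M N) (i, j) (potential z') (x, y))"
      using L t xy unfolding velocity_field_exists_def by blast+
    then have "\<forall>x'\<in>U. \<exists>w. has_gradient M i (potential x') x w" "\<forall>y'\<in>V. \<exists>w. has_gradient N j (potential y') y w"
      using xy ex[unfolded gradient_potential_exists_prod_iff[OF ij]] by blast+
    with int integrable_gradient_prod_iff[OF t ij] show ?thesis by blast
  qed
  show ?R
    unfolding velocity_field_exists_def
  proof (intro conjI ballI)
    fix t x i assume t: "t \<in> time_interval T" and x: "x \<in> U" "i \<in> charts_at M x"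
    obtain y where y: "y \<in> V" using prob_measures_1D(4)[OF \<sigma>[OF t]] by blast
    obtain j where j: "j \<in> charts_at N y" using charts_at_nonempty[OF N(1)] by blast
    show "integrable (\<mu> t) (\<lambda>x'. gradient M i (potential x') x)"
      using *[OF t x(1) y x(2) j] by blast
    show "\<exists>w. has_gradient M i (potential x') x w" if "x' \<in> U" for x'
      using *[OF t x(1) y x(2) j] that by blast
  next
    fix t y j assume t: "t \<in> time_interval T" and y: "y \<in> V" "j \<in> charts_at N y"
    obtain x where x: "x \<in> U" using prob_measures_1D(4)[OF \<sigma>[OF t]] by blast
    obtain i where i: "i \<in> charts_at M x" using charts_at_nonempty[OF M(1)] by blast
    show "integrable (\<nu> t) (\<lambda>y'. gradient N j (potential y') y)"
      using *[OF t x y(1) i y(2)] by blast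
    show "\<exists>w. has_gradient N j (potential y') y w" if "y' \<in> V" for y'
      using *[OF t x y(1) i y(2)] that by blast
  qed
next
  assume R: ?R
  show ?L
    unfolding velocity_field_exists_def
  proof (intro ballI conjI)
    fix t z k assume t: "t \<in> time_interval T" and z: "z \<in> U \<times> V" and k: "k \<in> charts_at (prod_manifold M N) z"
    obtain x y where xy: "z = (x, y)" "x \<in> U" "y \<in> V" using z by blast
    obtain i j where ij': "k = (i, j)" and ij: "i \<in> charts_at M x" "j \<in> charts_at N y"
      using k by (auto simp: xy charts_at_prod_manifold)
    have ex: "\<And>x'. x' \<in> U \<Longrightarrow> \<exists>w. has_gradient M i (potential x') x w"
        "\<And>y'. y' \<in> V \<Longrightarrow> \<exists>w. has_gradient N j (potential y') y w"
      and int: "integrable (\<mu> t) (\<lambda>x'. gradient M i (potential x') x)" "integrable (\<nu> t) (\<lambda>y'. gradient N j (potential y') y)"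
      using R t xy ij unfolding velocity_field_exists_def by blast+
    show "integrable (\<sigma> t) (\<lambda>z'. gradient (prod_manifold M N) k (potential z') z)"
      unfolding xy ij' using integrable_gradient_prod_iff[OF t ij ex] int by blast
    show "\<exists>w. has_gradient (prod_manifold M N) k (potential z') z w" if "z' \<in> U \<times> V" for z'
    proof -
      obtain x' y' where z': "z' = (x', y')" "x' \<in> U" "y' \<in> V" using \<open>z' \<in> U \<times> V\<close> by blast
      show ?thesis
        unfolding xy ij' z' gradient_potential_exists_prod_iff[OF ij] using ex z'(2,3) by blast
    qed
  qed
qed

lemma decoupled_velocity_field:
  assumes "velocity_field_exists M U T \<mu>" "velocity_field_exists N V T \<nu>"
  shows "decoupled M U N V T (velocity_field (prod_manifold M N) \<sigma>) (velocity_field M \<mu>) (velocity_field N \<nu>)"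
  unfolding decoupled_def
proof (intro ballI)
  fix t x y i j
  assume t: "t \<in> time_interval T" and xy: "x \<in> U" "y \<in> V" and ij: "i \<in> charts_at M x" "j \<in> charts_at N y"
  show "velocity_field (prod_manifold M N) \<sigma> (i, j) (x, y) t = (velocity_field M \<mu> i x t, velocity_field N \<nu> j y t)"
    using assms t xy ij unfolding velocity_field_exists_def
    by (intro velocity_field_prod[OF t ij]) blast+
qed

end

end

section \<open>Flows of decoupled vector fields\<close>

lemma flow_map_pair:
  assumes Z: "decoupled M U N V T Z X Y"
    and \<Psi>: "flow_map M U X A T \<Psi>" and \<Phi>: "flow_map N V Y B T \<Phi>"
  shows "flow_map (prod_manifold M N) (U \<times> V) Z (A \<times> B) T (\<lambda>t (x, y). (\<Psi> t x, \<Phi> t y))"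
  unfolding flow_map_def
proof (intro ballI conjI)
  fix z assume "z \<in> A \<times> B"
  then obtain x y where z: "z = (x, y)" "x \<in> A" "y \<in> B" by blast
  show "(case z of (x, y) \<Rightarrow> (\<Psi> 0 x, \<Phi> 0 y)) = z"
    using \<Psi> \<Phi> z by (simp add: flow_map_def)
  show "continuous_on (time_interval T) (\<lambda>t. case z of (x, y) \<Rightarrow> (\<Psi> t x, \<Phi> t y))"
    using \<Psi> \<Phi> z by (simp add: flow_map_def continuous_on_Pair)
  fix t assume t: "t \<in> time_interval T"
  show in_UV: "(case z of (x, y) \<Rightarrow> (\<Psi> t x, \<Phi> t y)) \<in> U \<times> V"
    using \<Psi> \<Phi> z t by (simp add: flow_map_def)
  fix k assume "k \<in> charts_at (prod_manifold M N) (case z of (x, y) \<Rightarrow> (\<Psi> t x, \<Phi> t y))"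
  then obtain i j where k: "k = (i, j)" and ij: "i \<in> charts_at M (\<Psi> t x)" "j \<in> charts_at N (\<Phi> t y)"
    using z by (auto simp: charts_at_prod_manifold)
  have Z': "Z (i, j) (\<Psi> t x, \<Phi> t y) t = (X i (\<Psi> t x) t, Y j (\<Phi> t y) t)"
    using Z t ij in_UV z by (simp add: decoupled_def)
  have "((\<lambda>s. chart M i (\<Psi> s x)) has_vector_derivative X i (\<Psi> t x) t) (at t within time_interval T)"
    "((\<lambda>s. chart N j (\<Phi> s y)) has_vector_derivative Y j (\<Phi> t y) t) (at t within time_interval T)"
    using \<Psi> \<Phi> z t ij by (simp_all add: flow_map_def)
  from has_vector_derivative_Pair[OF this]
  show "((\<lambda>s. chart (prod_manifold M N) k (case z of (x, y) \<Rightarrow> (\<Psi> s x, \<Phi> s y))) has_vector_derivative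
      Z k (case z of (x, y) \<Rightarrow> (\<Psi> t x, \<Phi> t y)) t) (at t within time_interval T)"
    by (simp add: z k Z' prod_manifold_simps)
qed

lemma has_vector_derivative_fst_snd:
  assumes "(h has_vector_derivative d) F"
  shows "((\<lambda>s. fst (h s)) has_vector_derivative fst d) F" "((\<lambda>s. snd (h s)) has_vector_derivative snd d) F"
  using has_derivative_fst[OF assms[unfolded has_vector_derivative_def]]
    has_derivative_snd[OF assms[unfolded has_vector_derivative_def]]
  by (simp_all add: has_vector_derivative_def)

text \<open>
  Freezing one variable of a flow of a decoupled field leaves a flow of the other component. A velocity
  in the product is tested in pairs of charts, so a chart around the frozen component has to be supplied.
\<close>

lemma flow_map_components:
  assumes M: "smooth_manifold M" and N: "smooth_manifold N"
    and Z: "decoupled M U N V T Z X Y"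
    and \<Theta>: "flow_map (prod_manifold M N) (U \<times> V) Z (A \<times> B) T \<Theta>"
  shows "y \<in> B \<Longrightarrow> flow_map M U X A T (\<lambda>t x. fst (\<Theta> t (x, y)))"
    and "x \<in> A \<Longrightarrow> flow_map N V Y B T (\<lambda>t y. snd (\<Theta> t (x, y)))"
proof -
  have \<Theta>0: "\<Theta> 0 (x, y) = (x, y)" and cont: "continuous_on (time_interval T) (\<lambda>t. \<Theta> t (x, y))"
    if "x \<in> A" "y \<in> B" for x y
    using \<Theta> that by (auto simp: flow_map_def)
  have in_UV: "fst (\<Theta> t (x, y)) \<in> U" "snd (\<Theta> t (x, y)) \<in> V"
    if "x \<in> A" "y \<in> B" "t \<in> time_interval T" for x y t
    using \<Theta> that by (auto simp: flow_map_def mem_Times_iff)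
  have deriv:
    "((\<lambda>s. chart M i (fst (\<Theta> s (x, y)))) has_vector_derivative X i (fst (\<Theta> t (x, y))) t) (at t within time_interval T)"
    "((\<lambda>s. chart N j (snd (\<Theta> s (x, y)))) has_vector_derivative Y j (snd (\<Theta> t (x, y))) t) (at t within time_interval T)"
    if "x \<in> A" "y \<in> B" "t \<in> time_interval T" "i \<in> charts_at M (fst (\<Theta> t (x, y)))" "j \<in> charts_at N (snd (\<Theta> t (x, y)))"
    for x y t i j
  proof -
    have c: "(i, j) \<in> charts_at (prod_manifold M N) (\<Theta> t (x, y))"
      using that(4,5) charts_at_prod_manifold[of M N "fst (\<Theta> t (x, y))" "snd (\<Theta> t (x, y))"] by simp
    have ch: "chart (prod_manifold M N) (i, j) z = (chart M i (fst z), chart N j (snd z))" for z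
      by (metis prod_manifold_simps(3) prod.collapse)
    have "Z (i, j) (\<Theta> t (x, y)) t = (X i (fst (\<Theta> t (x, y))) t, Y j (snd (\<Theta> t (x, y))) t)"
      using Z that in_UV[OF that(1-3)] unfolding decoupled_def by (metis prod.collapse)
    moreover have "((\<lambda>s. chart (prod_manifold M N) (i, j) (\<Theta> s (x, y))) has_vector_derivative
        Z (i, j) (\<Theta> t (x, y)) t) (at t within time_interval T)"
      using \<Theta> that(1-3) c unfolding flow_map_def by blast
    ultimately have *: "((\<lambda>s. (chart M i (fst (\<Theta> s (x, y))), chart N j (snd (\<Theta> s (x, y))))) has_vector_derivative
        (X i (fst (\<Theta> t (x, y))) t, Y j (snd (\<Theta> t (x, y))) t)) (at t within time_interval T)"
      by (simp only: ch)
    from has_vector_derivative_fst_snd[OF *]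
    show "((\<lambda>s. chart M i (fst (\<Theta> s (x, y)))) has_vector_derivative X i (fst (\<Theta> t (x, y))) t) (at t within time_interval T)"
      "((\<lambda>s. chart N j (snd (\<Theta> s (x, y)))) has_vector_derivative Y j (snd (\<Theta> t (x, y))) t) (at t within time_interval T)"
      by simp_all
  qed
  show "flow_map M U X A T (\<lambda>t x. fst (\<Theta> t (x, y)))" if y: "y \<in> B"
    unfolding flow_map_def
  proof (intro ballI conjI)
    fix x assume x: "x \<in> A"
    show "fst (\<Theta> 0 (x, y)) = x" "continuous_on (time_interval T) (\<lambda>t. fst (\<Theta> t (x, y)))"
      using \<Theta>0[OF x y] continuous_on_fst[OF cont[OF x y]] by simp_all
    fix t assume t: "t \<in> time_interval T"
    show "fst (\<Theta> t (x, y)) \<in> U" using in_UV(1)[OF x y t] .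
    obtain j where j: "j \<in> charts_at N (snd (\<Theta> t (x, y)))" using charts_at_nonempty[OF N] by blast
    show "((\<lambda>s. chart M i (fst (\<Theta> s (x, y)))) has_vector_derivative X i (fst (\<Theta> t (x, y))) t)
        (at t within time_interval T)" if "i \<in> charts_at M (fst (\<Theta> t (x, y)))" for i
      using deriv(1)[OF x y t that j] .
  qed
  show "flow_map N V Y B T (\<lambda>t y. snd (\<Theta> t (x, y)))" if x: "x \<in> A"
    unfolding flow_map_def
  proof (intro ballI conjI)
    fix y assume y: "y \<in> B"
    show "snd (\<Theta> 0 (x, y)) = y" "continuous_on (time_interval T) (\<lambda>t. snd (\<Theta> t (x, y)))"
      using \<Theta>0[OF x y] continuous_on_snd[OF cont[OF x y]] by simp_all
    fix t assume t: "t \<in> time_interval T"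
    show "snd (\<Theta> t (x, y)) \<in> V" using in_UV(2)[OF x y t] .
    obtain i where i: "i \<in> charts_at M (fst (\<Theta> t (x, y)))" using charts_at_nonempty[OF M] by blast
    show "((\<lambda>s. chart N j (snd (\<Theta> s (x, y)))) has_vector_derivative Y j (snd (\<Theta> t (x, y))) t)
        (at t within time_interval T)" if "j \<in> charts_at N (snd (\<Theta> t (x, y)))" for j
      using deriv(2)[OF x y t i that] .
  qed
qed

definition unique_flow_map ::
    "('i, 'a::metric_space, 'e::euclidean_space) riemannian_structure \<Rightarrow> 'a set \<Rightarrow>
     ('i \<Rightarrow> 'a \<Rightarrow> real \<Rightarrow> 'e) \<Rightarrow> 'a set \<Rightarrow> ereal \<Rightarrow> (real \<Rightarrow> 'a \<Rightarrow> 'a) \<Rightarrow> bool" where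
  "unique_flow_map M V X \<Sigma> T \<Psi> \<longleftrightarrow>
     flow_map M V X \<Sigma> T \<Psi> \<and>
     (\<forall>\<Phi>. flow_map M V X \<Sigma> T \<Phi> \<longrightarrow> (\<forall>t\<in>time_interval T. \<forall>z\<in>\<Sigma>. \<Phi> t z = \<Psi> t z))"

text \<open>
  The components of any other flow on the product are, with one variable frozen, flows on the factors,
  and so are known.
\<close>

lemma unique_flow_map_pair:
  assumes M: "smooth_manifold M" and N: "smooth_manifold N"
    and Z: "decoupled M U N V T Z X Y"
    and \<Psi>: "unique_flow_map M U X A T \<Psi>" and \<Phi>: "unique_flow_map N V Y B T \<Phi>"
  shows "unique_flow_map (prod_manifold M N) (U \<times> V) Z (A \<times> B) T (\<lambda>t (x, y). (\<Psi> t x, \<Phi> t y))"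
  unfolding unique_flow_map_def
proof (intro conjI allI impI ballI)
  show "flow_map (prod_manifold M N) (U \<times> V) Z (A \<times> B) T (\<lambda>t (x, y). (\<Psi> t x, \<Phi> t y))"
    using \<Psi> \<Phi> by (intro flow_map_pair[OF Z]) (simp_all add: unique_flow_map_def)
  fix \<Theta> t z
  assume \<Theta>: "flow_map (prod_manifold M N) (U \<times> V) Z (A \<times> B) T \<Theta>"
    and t: "t \<in> time_interval T" and "z \<in> A \<times> B"
  then obtain x y where z: "z = (x, y)" "x \<in> A" "y \<in> B" by blast
  have "fst (\<Theta> t (x, y)) = \<Psi> t x"
    using \<Psi> flow_map_components(1)[OF M N Z \<Theta> z(3)] t z(2) by (auto simp: unique_flow_map_def)
  moreover have "snd (\<Theta> t (x, y)) = \<Phi> t y"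
    using \<Phi> flow_map_components(2)[OF M N Z \<Theta> z(2)] t z(3) by (auto simp: unique_flow_map_def)
  ultimately show "\<Theta> t z = (case z of (x, y) \<Rightarrow> (\<Psi> t x, \<Phi> t y))"
    by (simp add: z prod_eq_iff)
qed

text \<open>
  The component flows are read off by freezing one variable at \<open>y0\<close>, respectively \<open>x0\<close>. Pairing them again
  gives a flow on the product, which by uniqueness is \<open>\<Theta>\<close> itself; so each component of \<open>\<Theta>\<close> depends on its
  own variable only. Pairing one of them with a competitor of the other one shows that the competitor
  is no different.
\<close>

lemma unique_flow_map_components:
  assumes M: "smooth_manifold M" and N: "smooth_manifold N"
    and Z: "decoupled M U N V T Z X Y"
    and \<Theta>: "unique_flow_map (prod_manifold M N) (U \<times> V) Z (A \<times> B) T \<Theta>"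
    and x0: "x0 \<in> A" and y0: "y0 \<in> B"
  defines "\<Psi> \<equiv> \<lambda>t x. fst (\<Theta> t (x, y0))" and "\<Phi> \<equiv> \<lambda>t y. snd (\<Theta> t (x0, y))"
  shows "unique_flow_map M U X A T \<Psi>" "unique_flow_map N V Y B T \<Phi>"
    and "t \<in> time_interval T \<Longrightarrow> x \<in> A \<Longrightarrow> y \<in> B \<Longrightarrow> \<Theta> t (x, y) = (\<Psi> t x, \<Phi> t y)"
proof -
  have flow: "flow_map (prod_manifold M N) (U \<times> V) Z (A \<times> B) T \<Theta>"
    and uniq: "\<And>\<Theta>' t x y. flow_map (prod_manifold M N) (U \<times> V) Z (A \<times> B) T \<Theta>' \<Longrightarrow> t \<in> time_interval T \<Longrightarrow>
      x \<in> A \<Longrightarrow> y \<in> B \<Longrightarrow> \<Theta>' t (x, y) = \<Theta> t (x, y)"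
    using \<Theta> by (auto simp: unique_flow_map_def)
  have \<Psi>: "flow_map M U X A T \<Psi>" and \<Phi>: "flow_map N V Y B T \<Phi>"
    unfolding \<Psi>_def \<Phi>_def using flow_map_components[OF M N Z flow] x0 y0 by blast+
  show split: "\<Theta> t (x, y) = (\<Psi> t x, \<Phi> t y)" if "t \<in> time_interval T" "x \<in> A" "y \<in> B" for t x y
    using uniq[OF flow_map_pair[OF Z \<Psi> \<Phi>] that] by simp
  show "unique_flow_map M U X A T \<Psi>"
    unfolding unique_flow_map_def
  proof (intro conjI allI impI ballI)
    fix \<Psi>' t x assume \<Psi>': "flow_map M U X A T \<Psi>'" and t: "t \<in> time_interval T" and x: "x \<in> A"
    show "\<Psi>' t x = \<Psi> t x"
      using uniq[OF flow_map_pair[OF Z \<Psi>' \<Phi>] t x y0] split[OF t x y0] by simp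
  qed (rule \<Psi>)
  show "unique_flow_map N V Y B T \<Phi>"
    unfolding unique_flow_map_def
  proof (intro conjI allI impI ballI)
    fix \<Phi>' t y assume \<Phi>': "flow_map N V Y B T \<Phi>'" and t: "t \<in> time_interval T" and y: "y \<in> B"
    show "\<Phi>' t y = \<Phi> t y"
      using uniq[OF flow_map_pair[OF Z \<Psi> \<Phi>'] t x0 y] split[OF t x0 y] by simp
  qed (rule \<Phi>)
qed

section \<open>Weak solutions on a product\<close>

lemma pushforward_pair:
  fixes \<mu> :: "'a::second_countable_topology measure" and \<nu> :: "'b::second_countable_topology measure"
  assumes \<mu>: "sets \<mu> = sets (restrict_space borel U)" "prob_space \<mu>"
    and \<nu>: "sets \<nu> = sets (restrict_space borel V)" "prob_space \<nu>"
    and f: "f \<in> restrict_space \<mu> (supp \<mu>) \<rightarrow>\<^sub>M restrict_space borel U"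
    and g: "g \<in> restrict_space \<nu> (supp \<nu>) \<rightarrow>\<^sub>M restrict_space borel V"
  defines "R \<equiv> restrict_space (\<mu> \<Otimes>\<^sub>M \<nu>) (supp (\<mu> \<Otimes>\<^sub>M \<nu>))"
  shows "(\<lambda>(x, y). (f x, g y)) \<in> R \<rightarrow>\<^sub>M restrict_space borel (U \<times> V)"
    and "distr R (restrict_space borel (U \<times> V)) (\<lambda>(x, y). (f x, g y)) =
      distr (restrict_space \<mu> (supp \<mu>)) (restrict_space borel U) f \<Otimes>\<^sub>M
      distr (restrict_space \<nu> (supp \<nu>)) (restrict_space borel V) g"
proof -
  have R: "R = restrict_space \<mu> (supp \<mu>) \<Otimes>\<^sub>M restrict_space \<nu> (supp \<nu>)"
    unfolding R_def supp_pair[OF \<mu> \<nu>]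
    using restrict_space_pair_measure[OF \<mu>(2) \<nu>(2) supp_in_sets[OF \<mu>(1)] supp_in_sets[OF \<nu>(1)]] by simp
  have "(\<lambda>(x, y). (f x, g y)) \<in> R \<rightarrow>\<^sub>M restrict_space borel U \<Otimes>\<^sub>M restrict_space borel V"
    unfolding R case_prod_unfold
    by (intro measurable_Pair measurable_compose[OF measurable_fst f] measurable_compose[OF measurable_snd g])
  then show "(\<lambda>(x, y). (f x, g y)) \<in> R \<rightarrow>\<^sub>M restrict_space borel (U \<times> V)"
    by (simp add: measurable_cong_sets[OF refl sets_borel_restrict_pair])
  interpret \<nu>': prob_space "restrict_space \<nu> (supp \<nu>)"
    by (rule prob_space_restrict_space[OF supp_in_sets[OF \<nu>(1)] emeasure_supp[OF \<nu>]])
  interpret g\<nu>: prob_space "distr (restrict_space \<nu> (supp \<nu>)) (restrict_space borel V) g"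
    by (rule \<nu>'.prob_space_distr[OF g])
  show "distr R (restrict_space borel (U \<times> V)) (\<lambda>(x, y). (f x, g y)) =
      distr (restrict_space \<mu> (supp \<mu>)) (restrict_space borel U) f \<Otimes>\<^sub>M
      distr (restrict_space \<nu> (supp \<nu>)) (restrict_space borel V) g"
    unfolding pair_measure_distr[OF f g g\<nu>.sigma_finite_measure_axioms] R
    by (rule distr_cong) (simp_all add: sets_borel_restrict_pair)
qed

lemma weak_solution_altdef:
  "weak_solution M V T \<rho> \<longleftrightarrow>
     0 < T \<and> \<rho> \<in> curves_P1 V T \<and> velocity_field_exists M V T \<rho> \<and>
     (\<exists>\<Psi>. unique_flow_map M V (velocity_field M \<rho>) (supp (\<rho> 0)) T \<Psi> \<and>
        (\<forall>t\<in>time_interval T.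
           \<Psi> t \<in> restrict_space (\<rho> 0) (supp (\<rho> 0)) \<rightarrow>\<^sub>M restrict_space borel V \<and>
           \<rho> t = distr (restrict_space (\<rho> 0) (supp (\<rho> 0))) (restrict_space borel V) (\<Psi> t)))"
  unfolding weak_solution_def unique_flow_map_def by (simp only: conj_assoc)

text \<open>
  The base measure is restricted to its support, as the flow prescribes trajectories only there.
\<close>

lemma narrowly_continuous_flow:
  fixes \<mu> :: "'a::{metric_space,second_countable_topology} measure"
  assumes \<mu>: "sets \<mu> = sets (restrict_space borel V)" "prob_space \<mu>"
    and flow: "flow_map M V X (supp \<mu>) T \<Psi>"
    and "\<And>t. t \<in> time_interval T \<Longrightarrow> \<Psi> t \<in> restrict_space \<mu> (supp \<mu>) \<rightarrow>\<^sub>M restrict_space borel V"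
    and "\<And>t. t \<in> time_interval T \<Longrightarrow> \<rho> t = distr (restrict_space \<mu> (supp \<mu>)) (restrict_space borel V) (\<Psi> t)"
  shows "narrowly_continuous V T \<rho>"
proof (rule narrowly_continuous_pushforward)
  interpret prob_space "restrict_space \<mu> (supp \<mu>)"
    by (rule prob_space_restrict_space[OF supp_in_sets[OF \<mu>(1)] emeasure_supp[OF \<mu>]])
  show "finite_measure (restrict_space \<mu> (supp \<mu>))" by (rule finite_measure_axioms)
  show "continuous_on (time_interval T) (\<lambda>t. \<Psi> t z)" if "z \<in> space (restrict_space \<mu> (supp \<mu>))" for z
    using flow that by (simp add: flow_map_def space_restrict_space)
qed (use assms in auto)

lemma weak_solution_pair:
  fixes M :: "('i, 'a::{metric_space,second_countable_topology}, 'e::euclidean_space) riemannian_structure"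
    and N :: "('j, 'b::{metric_space,second_countable_topology}, 'f::euclidean_space) riemannian_structure"
  assumes M: "smooth_manifold M" "metric_tensor M" and N: "smooth_manifold N" "metric_tensor N"
    and \<mu>: "weak_solution M U T \<mu>" and \<nu>: "weak_solution N V T \<nu>"
  shows "weak_solution (prod_manifold M N) (U \<times> V) T (\<lambda>t. \<mu> t \<Otimes>\<^sub>M \<nu> t)"
proof -
  let ?\<sigma> = "\<lambda>t. \<mu> t \<Otimes>\<^sub>M \<nu> t"
  from \<mu> obtain \<Psi> where T: "0 < T" and \<mu>P: "\<And>t. t \<in> time_interval T \<Longrightarrow> \<mu> t \<in> prob_measures_1 U"
    and \<mu>ex: "velocity_field_exists M U T \<mu>"
    and \<Psi>: "unique_flow_map M U (velocity_field M \<mu>) (supp (\<mu> 0)) T \<Psi>"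
    and \<Psi>m: "\<And>t. t \<in> time_interval T \<Longrightarrow> \<Psi> t \<in> restrict_space (\<mu> 0) (supp (\<mu> 0)) \<rightarrow>\<^sub>M restrict_space borel U"
    and \<mu>t: "\<And>t. t \<in> time_interval T \<Longrightarrow> \<mu> t = distr (restrict_space (\<mu> 0) (supp (\<mu> 0))) (restrict_space borel U) (\<Psi> t)"
    unfolding weak_solution_altdef curves_P1_def by blast
  from \<nu> obtain \<Phi> where \<nu>P: "\<And>t. t \<in> time_interval T \<Longrightarrow> \<nu> t \<in> prob_measures_1 V"
    and \<nu>ex: "velocity_field_exists N V T \<nu>"
    and \<Phi>: "unique_flow_map N V (velocity_field N \<nu>) (supp (\<nu> 0)) T \<Phi>"
    and \<Phi>m: "\<And>t. t \<in> time_interval T \<Longrightarrow> \<Phi> t \<in> restrict_space (\<nu> 0) (supp (\<nu> 0)) \<rightarrow>\<^sub>M restrict_space borel V"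
    and \<nu>t: "\<And>t. t \<in> time_interval T \<Longrightarrow> \<nu> t = distr (restrict_space (\<nu> 0) (supp (\<nu> 0))) (restrict_space borel V) (\<Phi> t)"
    unfolding weak_solution_altdef curves_P1_def by blast
  have 0: "0 \<in> time_interval T" using T by (simp add: time_interval_def zero_ereal_def)
  note \<mu>0 = prob_measures_1D(1,2)[OF \<mu>P[OF 0]] and \<nu>0 = prob_measures_1D(1,2)[OF \<nu>P[OF 0]]
  have \<sigma>P: "?\<sigma> t \<in> prob_measures_1 (U \<times> V)" if "t \<in> time_interval T" for t
    using prob_measures_1_pair \<mu>P \<nu>P that by blast
  have marg: "fst_marginal U (?\<sigma> t) = \<mu> t" "snd_marginal V (?\<sigma> t) = \<nu> t" if "t \<in> time_interval T" for t
    using marginals_pair_measure[OF prob_measures_1D(1,2)[OF \<mu>P[OF that]] prob_measures_1D(1,2)[OF \<nu>P[OF that]]] .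
  have ex: "velocity_field_exists (prod_manifold M N) (U \<times> V) T ?\<sigma>"
    using velocity_field_exists_prod_iff[OF M N, where \<sigma> = ?\<sigma> and \<mu> = \<mu> and \<nu> = \<nu>, OF \<sigma>P marg] \<mu>ex \<nu>ex by blast
  have "decoupled M U N V T (velocity_field (prod_manifold M N) ?\<sigma>) (velocity_field M \<mu>) (velocity_field N \<nu>)"
    by (rule decoupled_velocity_field[OF M N, where \<sigma> = ?\<sigma> and \<mu> = \<mu> and \<nu> = \<nu>, OF \<sigma>P marg \<mu>ex \<nu>ex])
  from unique_flow_map_pair[OF M(1) N(1) this \<Psi> \<Phi>]
  have flow: "unique_flow_map (prod_manifold M N) (U \<times> V) (velocity_field (prod_manifold M N) ?\<sigma>)
      (supp (?\<sigma> 0)) T (\<lambda>t (x, y). (\<Psi> t x, \<Phi> t y))"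
    by (simp add: supp_pair[OF \<mu>0 \<nu>0])
  note push = pushforward_pair[OF \<mu>0 \<nu>0 \<Psi>m \<Phi>m]
  have push2: "?\<sigma> t = distr (restrict_space (?\<sigma> 0) (supp (?\<sigma> 0))) (restrict_space borel (U \<times> V)) (\<lambda>(x, y). (\<Psi> t x, \<Phi> t y))"
    if t: "t \<in> time_interval T" for t
    unfolding push(2)[OF t t] using \<mu>t[OF t] \<nu>t[OF t] by simp
  have "narrowly_continuous (U \<times> V) T ?\<sigma>"
    using flow push(1) push2 prob_measures_1D(1,2)[OF \<sigma>P[OF 0]]
    by (intro narrowly_continuous_flow[of "?\<sigma> 0"]) (auto simp: unique_flow_map_def)
  with T \<sigma>P ex flow push(1) push2 show ?thesis
    unfolding weak_solution_altdef curves_P1_def by blast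
qed

text \<open>
  The velocity field of \<open>\<sigma>\<close> is that of its marginals in each component, so the unique flow of \<open>\<sigma>\<close> acts on the
  two variables separately. Such a map sends a product measure to a product measure, whose factors are
  the initial factors transported by the component flows. Thus \<open>\<sigma>\<close> stays a tensor product
  at all times, and each marginal is transported by its own velocity field.
\<close>

lemma weak_solution_marginals:
  fixes M :: "('i, 'a::{metric_space,second_countable_topology}, 'e::euclidean_space) riemannian_structure"
    and N :: "('j, 'b::{metric_space,second_countable_topology}, 'f::euclidean_space) riemannian_structure"
  assumes M: "smooth_manifold M" "metric_tensor M" and N: "smooth_manifold N" "metric_tensor N"
    and \<sigma>: "weak_solution (prod_manifold M N) (U \<times> V) T \<sigma>"
    and \<sigma>0: "\<sigma> 0 = \<mu>\<^sub>0 \<Otimes>\<^sub>M \<nu>\<^sub>0"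
    and \<mu>0: "sets \<mu>\<^sub>0 = sets (restrict_space borel U)" "prob_space \<mu>\<^sub>0"
    and \<nu>0: "sets \<nu>\<^sub>0 = sets (restrict_space borel V)" "prob_space \<nu>\<^sub>0"
  shows "weak_solution M U T (\<lambda>t. fst_marginal U (\<sigma> t))"
    and "weak_solution N V T (\<lambda>t. snd_marginal V (\<sigma> t))"
    and "t \<in> time_interval T \<Longrightarrow> \<sigma> t = fst_marginal U (\<sigma> t) \<Otimes>\<^sub>M snd_marginal V (\<sigma> t)"
proof -
  let ?\<mu> = "\<lambda>t. fst_marginal U (\<sigma> t)" and ?\<nu> = "\<lambda>t. snd_marginal V (\<sigma> t)"
  from \<sigma> obtain \<Theta> where T: "0 < T" and \<sigma>P: "\<And>t. t \<in> time_interval T \<Longrightarrow> \<sigma> t \<in> prob_measures_1 (U \<times> V)"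
    and \<sigma>ex: "velocity_field_exists (prod_manifold M N) (U \<times> V) T \<sigma>"
    and \<Theta>: "unique_flow_map (prod_manifold M N) (U \<times> V) (velocity_field (prod_manifold M N) \<sigma>) (supp (\<sigma> 0)) T \<Theta>"
    and \<Theta>m: "\<And>t. t \<in> time_interval T \<Longrightarrow> \<Theta> t \<in> restrict_space (\<sigma> 0) (supp (\<sigma> 0)) \<rightarrow>\<^sub>M restrict_space borel (U \<times> V)"
    and \<sigma>t: "\<And>t. t \<in> time_interval T \<Longrightarrow> \<sigma> t = distr (restrict_space (\<sigma> 0) (supp (\<sigma> 0))) (restrict_space borel (U \<times> V)) (\<Theta> t)"
    unfolding weak_solution_altdef curves_P1_def by blast
  have \<mu>\<nu>0: "?\<mu> 0 = \<mu>\<^sub>0" "?\<nu> 0 = \<nu>\<^sub>0"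
    unfolding \<sigma>0 using marginals_pair_measure[OF \<mu>0 \<nu>0] by auto
  have supp0: "supp (\<sigma> 0) = supp \<mu>\<^sub>0 \<times> supp \<nu>\<^sub>0"
    unfolding \<sigma>0 by (rule supp_pair[OF \<mu>0 \<nu>0])
  obtain x0 y0 where x0: "x0 \<in> supp \<mu>\<^sub>0" and y0: "y0 \<in> supp \<nu>\<^sub>0"
    using supp_nonempty[OF \<mu>0] supp_nonempty[OF \<nu>0] by blast
  have ex: "velocity_field_exists M U T ?\<mu>" "velocity_field_exists N V T ?\<nu>"
    using velocity_field_exists_prod_iff[OF M N \<sigma>P refl refl] \<sigma>ex by auto
  have dec: "decoupled M U N V T (velocity_field (prod_manifold M N) \<sigma>) (velocity_field M ?\<mu>) (velocity_field N ?\<nu>)"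
    by (rule decoupled_velocity_field[OF M N \<sigma>P refl refl ex])
  define \<Psi> where "\<Psi> = (\<lambda>t x. fst (\<Theta> t (x, y0)))"
  define \<Phi> where "\<Phi> = (\<lambda>t y. snd (\<Theta> t (x0, y)))"
  note comps = unique_flow_map_components(1,2)[OF M(1) N(1) dec \<Theta>[unfolded supp0] x0 y0, folded \<Psi>_def \<Phi>_def]
  \<comment> \<open>Freezing one variable at a point of the support also shows the component flows to be measurable.\<close>
  have split: "\<Theta> t (x, y) = (\<Psi> t x, \<Phi> t y)" if "t \<in> time_interval T" "x \<in> supp \<mu>\<^sub>0" "y \<in> supp \<nu>\<^sub>0" for t x y
    unfolding \<Psi>_def \<Phi>_def
    by (rule unique_flow_map_components(3)[OF M(1) N(1) dec \<Theta>[unfolded supp0] x0 y0 that])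
  have R: "restrict_space (\<sigma> 0) (supp (\<sigma> 0)) = restrict_space \<mu>\<^sub>0 (supp \<mu>\<^sub>0) \<Otimes>\<^sub>M restrict_space \<nu>\<^sub>0 (supp \<nu>\<^sub>0)"
    unfolding supp0 unfolding \<sigma>0
    using restrict_space_pair_measure[OF \<mu>0(2) \<nu>0(2) supp_in_sets[OF \<mu>0(1)] supp_in_sets[OF \<nu>0(1)]] by simp
  have spaces: "space (restrict_space \<mu>\<^sub>0 (supp \<mu>\<^sub>0)) = supp \<mu>\<^sub>0" "space (restrict_space \<nu>\<^sub>0 (supp \<nu>\<^sub>0)) = supp \<nu>\<^sub>0"
    by (auto simp: space_restrict_space supp_def)
  have \<Psi>m: "\<Psi> t \<in> restrict_space \<mu>\<^sub>0 (supp \<mu>\<^sub>0) \<rightarrow>\<^sub>M restrict_space borel U"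
    and \<Phi>m: "\<Phi> t \<in> restrict_space \<nu>\<^sub>0 (supp \<nu>\<^sub>0) \<rightarrow>\<^sub>M restrict_space borel V" if t: "t \<in> time_interval T" for t
    unfolding \<Psi>_def \<Phi>_def
    using x0 y0 spaces
    by (auto intro!: measurable_compose[OF _ measurable_fst_snd_restrict_borel(1)[OF refl]]
        measurable_compose[OF _ measurable_fst_snd_restrict_borel(2)[OF refl]]
        measurable_compose[OF _ \<Theta>m[OF t, unfolded R]] measurable_Pair1' measurable_Pair2')
  note push = pushforward_pair(2)[OF \<mu>0 \<nu>0 \<Psi>m \<Phi>m, folded \<sigma>0]
  have prods: "prob_space (distr (restrict_space \<mu>\<^sub>0 (supp \<mu>\<^sub>0)) (restrict_space borel U) (\<Psi> t))"
      "prob_space (distr (restrict_space \<nu>\<^sub>0 (supp \<nu>\<^sub>0)) (restrict_space borel V) (\<Phi> t))" if t: "t \<in> time_interval T" for t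
    using prob_space.prob_space_distr[OF prob_space_restrict_space[OF supp_in_sets[OF \<mu>0(1)] emeasure_supp[OF \<mu>0]] \<Psi>m[OF t]]
      prob_space.prob_space_distr[OF prob_space_restrict_space[OF supp_in_sets[OF \<nu>0(1)] emeasure_supp[OF \<nu>0]] \<Phi>m[OF t]] .
  have \<sigma>t': "\<sigma> t = distr (restrict_space \<mu>\<^sub>0 (supp \<mu>\<^sub>0)) (restrict_space borel U) (\<Psi> t) \<Otimes>\<^sub>M
      distr (restrict_space \<nu>\<^sub>0 (supp \<nu>\<^sub>0)) (restrict_space borel V) (\<Phi> t)" if t: "t \<in> time_interval T" for t
    unfolding push[OF t t, symmetric]
    by (subst \<sigma>t[OF t], rule distr_cong) (auto simp: space_restrict_space supp0 split[OF t])
  have \<mu>t: "?\<mu> t = distr (restrict_space \<mu>\<^sub>0 (supp \<mu>\<^sub>0)) (restrict_space borel U) (\<Psi> t)"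
    and \<nu>t: "?\<nu> t = distr (restrict_space \<nu>\<^sub>0 (supp \<nu>\<^sub>0)) (restrict_space borel V) (\<Phi> t)" if t: "t \<in> time_interval T" for t
    unfolding \<sigma>t'[OF t]
    using marginals_pair_measure[OF _ prods(1)[OF t] _ prods(2)[OF t]] by simp_all
  show "\<sigma> t = ?\<mu> t \<Otimes>\<^sub>M ?\<nu> t" if "t \<in> time_interval T" for t
    unfolding \<mu>t[OF that] \<nu>t[OF that] by (rule \<sigma>t'[OF that])
  have "narrowly_continuous U T ?\<mu>"
    by (rule narrowly_continuous_flow[OF \<mu>0 _ \<Psi>m \<mu>t]) (use comps(1) in \<open>auto simp: unique_flow_map_def\<close>)
  then show "weak_solution M U T ?\<mu>"
    unfolding weak_solution_altdef curves_P1_def \<mu>\<nu>0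
    using T ex(1) comps(1) \<Psi>m \<mu>t prob_measures_1_marginals(1)[OF \<sigma>P] by blast
  have "narrowly_continuous V T ?\<nu>"
    by (rule narrowly_continuous_flow[OF \<nu>0 _ \<Phi>m \<nu>t]) (use comps(2) in \<open>auto simp: unique_flow_map_def\<close>)
  then show "weak_solution N V T ?\<nu>"
    unfolding weak_solution_altdef curves_P1_def \<mu>\<nu>0
    using T ex(2) comps(2) \<Phi>m \<nu>t prob_measures_1_marginals(2)[OF \<sigma>P] by blast
qed

text \<open>
  A competitor on the product has marginals that are solutions on the factors with the given initial
  data. Uniqueness on the factors identifies them, and a competitor is the tensor product of its marginals.
\<close>

lemma unique_global_weak_solution_pair:
  fixes M :: "('i, 'a::{metric_space,second_countable_topology}, 'e::euclidean_space) riemannian_structure"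
    and N :: "('j, 'b::{metric_space,second_countable_topology}, 'f::euclidean_space) riemannian_structure"
  assumes M: "smooth_manifold M" "metric_tensor M" and N: "smooth_manifold N" "metric_tensor N"
    and \<mu>: "unique_global_weak_solution M U \<mu>" and \<nu>: "unique_global_weak_solution N V \<nu>"
  shows "unique_global_weak_solution (prod_manifold M N) (U \<times> V) (\<lambda>t. \<mu> t \<Otimes>\<^sub>M \<nu> t)"
  unfolding unique_global_weak_solution_def
proof (intro conjI allI impI)
  have \<mu>w: "weak_solution M U \<infinity> \<mu>" and \<nu>w: "weak_solution N V \<infinity> \<nu>"
    using \<mu> \<nu> by (simp_all add: unique_global_weak_solution_def)
  then show "weak_solution (prod_manifold M N) (U \<times> V) \<infinity> (\<lambda>t. \<mu> t \<Otimes>\<^sub>M \<nu> t)"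
    by (rule weak_solution_pair[OF M N])
  fix \<sigma> and t :: real
  assume \<sigma>: "weak_solution (prod_manifold M N) (U \<times> V) \<infinity> \<sigma> \<and> \<sigma> 0 = \<mu> 0 \<Otimes>\<^sub>M \<nu> 0" and "0 \<le> t"
  then have t: "t \<in> time_interval \<infinity>" by (simp add: time_interval_def)
  have "0 \<in> time_interval \<infinity>" by (simp add: time_interval_def)
  then have "\<mu> 0 \<in> prob_measures_1 U" "\<nu> 0 \<in> prob_measures_1 V"
    using \<mu>w \<nu>w by (simp_all add: weak_solution_def curves_P1_def)
  note \<mu>\<nu>0 = prob_measures_1D(1,2)[OF this(1)] prob_measures_1D(1,2)[OF this(2)]
  note marg = weak_solution_marginals[OF M N conjunct1[OF \<sigma>] conjunct2[OF \<sigma>] \<mu>\<nu>0]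
  have "fst_marginal U (\<sigma> 0) = \<mu> 0" "snd_marginal V (\<sigma> 0) = \<nu> 0"
    using \<sigma> marginals_pair_measure[OF \<mu>\<nu>0] by simp_all
  then have "fst_marginal U (\<sigma> t) = \<mu> t" "snd_marginal V (\<sigma> t) = \<nu> t"
    using \<mu> \<nu> marg(1,2) \<open>0 \<le> t\<close> unfolding unique_global_weak_solution_def by blast+
  then show "\<sigma> t = \<mu> t \<Otimes>\<^sub>M \<nu> t"
    using marg(3)[OF t] by simp
qed

theorem proposition5p5:
  fixes M\<^sub>1 :: "('i, 'a::polish_space, 'e::euclidean_space) riemannian_structure"
    and M\<^sub>2 :: "('j, 'b::polish_space, 'f::euclidean_space) riemannian_structure"
    and U\<^sub>1 Q\<^sub>1 :: "'a set" and U\<^sub>2 Q\<^sub>2 :: "'b set"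
    and \<rho>\<^sub>1 :: "real \<Rightarrow> 'a measure" and \<rho>\<^sub>2 :: "real \<Rightarrow> 'b measure"
    and p :: 'a and q :: 'b and tbar :: real
  assumes "complete_connected_riemannian_manifold M\<^sub>1"
    and "complete_connected_riemannian_manifold M\<^sub>2"
    and "open U\<^sub>1" and "geodesically_convex M\<^sub>1 U\<^sub>1"
    and "open U\<^sub>2" and "geodesically_convex M\<^sub>2 U\<^sub>2"
    and "unique_global_weak_solution M\<^sub>1 U\<^sub>1 \<rho>\<^sub>1"
    and "unique_global_weak_solution M\<^sub>2 U\<^sub>2 \<rho>\<^sub>2"
    and "p \<in> U\<^sub>1" and "((\<lambda>t. W1 (\<rho>\<^sub>1 t) (dirac_on U\<^sub>1 p)) \<longlongrightarrow> 0) at_top"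
    and "q \<in> U\<^sub>2" and "((\<lambda>t. W1 (\<rho>\<^sub>2 t) (dirac_on U\<^sub>2 q)) \<longlongrightarrow> 0) at_top"
    and "tbar > 0"
    and "compact Q\<^sub>1" and "Q\<^sub>1 \<subseteq> U\<^sub>1" and "\<And>t. t \<ge> tbar \<Longrightarrow> supp (\<rho>\<^sub>1 t) \<subseteq> Q\<^sub>1"
    and "compact Q\<^sub>2" and "Q\<^sub>2 \<subseteq> U\<^sub>2" and "\<And>t. t \<ge> tbar \<Longrightarrow> supp (\<rho>\<^sub>2 t) \<subseteq> Q\<^sub>2"
  shows "unique_global_weak_solution (prod_manifold M\<^sub>1 M\<^sub>2) (U\<^sub>1 \<times> U\<^sub>2) (\<lambda>t. \<rho>\<^sub>1 t \<Otimes>\<^sub>M \<rho>\<^sub>2 t) \<and>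
    ((\<lambda>t. W1 (\<rho>\<^sub>1 t \<Otimes>\<^sub>M \<rho>\<^sub>2 t) (dirac_on (U\<^sub>1 \<times> U\<^sub>2) (p, q))) \<longlongrightarrow> 0) at_top"
proof
  have "smooth_manifold M\<^sub>1" "metric_tensor M\<^sub>1" "smooth_manifold M\<^sub>2" "metric_tensor M\<^sub>2"
    using assms(1,2) by (simp_all add: complete_connected_riemannian_manifold_def)
  then show "unique_global_weak_solution (prod_manifold M\<^sub>1 M\<^sub>2) (U\<^sub>1 \<times> U\<^sub>2) (\<lambda>t. \<rho>\<^sub>1 t \<Otimes>\<^sub>M \<rho>\<^sub>2 t)"
    using assms(7,8) by (rule unique_global_weak_solution_pair)
  have P1: "\<rho>\<^sub>1 t \<in> prob_measures_1 U\<^sub>1" "\<rho>\<^sub>2 t \<in> prob_measures_1 U\<^sub>2" if "0 \<le> t" for t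
  proof -
    have "weak_solution M\<^sub>1 U\<^sub>1 \<infinity> \<rho>\<^sub>1" "weak_solution M\<^sub>2 U\<^sub>2 \<infinity> \<rho>\<^sub>2"
      using assms(7,8) unfolding unique_global_weak_solution_def by blast+
    with that show "\<rho>\<^sub>1 t \<in> prob_measures_1 U\<^sub>1" "\<rho>\<^sub>2 t \<in> prob_measures_1 U\<^sub>2"
      unfolding weak_solution_def curves_P1_def time_interval_def by simp_all
  qed
  have "\<forall>\<^sub>F t in at_top. W1 (\<rho>\<^sub>1 t \<Otimes>\<^sub>M \<rho>\<^sub>2 t) (dirac_on (U\<^sub>1 \<times> U\<^sub>2) (p, q))
      \<le> W1 (\<rho>\<^sub>1 t) (dirac_on U\<^sub>1 p) + W1 (\<rho>\<^sub>2 t) (dirac_on U\<^sub>2 q)"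
    using eventually_ge_at_top[of 0]
  proof eventually_elim
    case (elim t)
    note \<rho> = prob_measures_1D(1,2)[OF P1(1)[OF elim]] prob_measures_1D(1,2)[OF P1(2)[OF elim]]
    show ?case by (rule W1_pair_dirac_le[OF \<rho>(1,2) assms(9) \<rho>(3,4) assms(11)])
  qed
  moreover have "((\<lambda>t. W1 (\<rho>\<^sub>1 t) (dirac_on U\<^sub>1 p) + W1 (\<rho>\<^sub>2 t) (dirac_on U\<^sub>2 q)) \<longlongrightarrow> 0) at_top"
    using tendsto_add[OF assms(10,12)] by simp
  ultimately show "((\<lambda>t. W1 (\<rho>\<^sub>1 t \<Otimes>\<^sub>M \<rho>\<^sub>2 t) (dirac_on (U\<^sub>1 \<times> U\<^sub>2) (p, q))) \<longlongrightarrow> 0) at_top"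
    by (rule tendsto_sandwich[OF _ _ tendsto_const, rotated]) simp_all
qed

end
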